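(* Let $M$ be a manifold of dimension $n\geq 2$, fix a valid set of inputs $(N,0,\underline N,F)$ as described in the context, and let $\nabla$ be a torsion-free affine connection on $M$ such that $||Q^{\underline N,F}||$ is nowhere zero. Let $G^{(Q)}_{ij}$, $E^{(Q)}_{ijk}$, $\gamma^{(Q)}$ be the natural projective invariants built from $D_{(Q)}$ as in the context. Then $G^{(Q)}_{ij}$ completely obstructs the projective class of $\nabla$ containing a Ricci-flat connection: $\nabla$ is projectively equivalent to a Ricci-flat (torsion-free affine) connection if and only if $G^{(Q)}_{ij}=0$. Moreover the following are equivalent: (1) $\nabla$ is projectively equivalent to the Levi-Civita connection of an Einstein metric with nonvanishing Einstein constant. (2) The natural projective invariants $E^{(Q)}_{ijk}$ and $G^{(Q)}_{[ij]}$ are each zero, while $\gamma^{(Q)}$ is nowhere zero (i.e. $G^{(Q)}_{ij}$ is everywhere nondegenerate).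
   Context: Metrics are pseudo-Riemannian of any signature; $g$ is Einstein if $\mathrm{Ric}_{ab}$ is a constant multiple of $g_{ab}$ (the constant is the Einstein constant). Torsion-free connections $\nabla,\widehat\nabla$ are projectively equivalent iff $\widehat\nabla_au_b=\nabla_au_b-\Upsilon_au_b-\Upsilon_bu_a$ for some 1-form $\Upsilon$. Curvature: $(\nabla_a\nabla_b-\nabla_b\nabla_a)v^c=R_{ab}{}^c{}_dv^d$, $\mathrm{Ric}_{ab}=R_{ca}{}^c{}_b$. Decompose uniquely $R_{ab}{}^c{}_d=W_{ab}{}^c{}_d+2\delta^c_{[a}P_{b]d}+\beta_{ab}\delta^c_d$ with $W$ (projective Weyl tensor) completely trace-free and $\beta_{ab}=-2P_{[ab]}$; thus $(n-1)P_{ab}=\mathrm{Ric}_{ab}+\beta_{ab}$. Cotton tensor: $C_{dab}=2\nabla_{[a}P_{b]d}$. Valid inputs: a valid set of inputs $(N,R,\underline N,F)$ consists of (i) a nonnegative integer $R<n$ and an even natural number $2N$ such that $2N+R$ is a multiple of $n$; (ii) a partition $\underline N$: $N_0+N_1+\cdots+N_r=N$ of $N$; (iii) a function $F:\coprod_{j=0}^r\{1,\dots,2N_j\}\to\{1,\dots,(2N+R)/n\}$ such that $|F^{-1}(i)|=n$ for each $i\in\{2,\dots,(2N+R)/n\}$ (but not necessarily for $i=1$); thus $|F^{-1}(1)|=n-R$. Elements of the disjoint union are written $(j,\alpha)$. Construction of $Q$: put $(P^k)_{a_1\cdots a_{2k}}{}^s{}_t:=W_{a_1a_2}{}^{c_1}{}_tW_{a_3a_4}{}^{c_2}{}_{c_1}\cdots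 W_{a_{2k-1}a_{2k}}{}^s{}_{c_{k-1}}$ (a composition of $k$ factors $W$). In the tensor $(P^{N_0})_{a^0_1\cdots a^0_{2N_0}}{}^s{}_t\prod_{j=1}^r(P^{N_j})_{a^j_1\cdots a^j_{2N_j}}{}^{c_j}{}_{c_j}$, for each $i\in\{2,\dots,(2N+R)/n\}$ skew over the $n$ indices $\{a^j_\alpha:F(j,\alpha)=i\}$, and for $i=1$ skew over the $n-R$ indices $\{a^j_\alpha:F(j,\alpha)=1\}$. Via the natural ("Hodge-star") isomorphism $\Lambda^{n-R}(T^*M)\cong\Lambda^R(TM)\otimes\Lambda^n(T^*M)$, identify the result with a section $(Q^{\underline N,F})^{b_1\cdots b_R}{}_t{}^s$ of $\Lambda^R(TM)\otimes\mathrm{End}(TM)\otimes(\Lambda^n(T^*M))^{(2N+R)/n}$. Now take a valid set of inputs $(N,0,\underline N,F)$, i.e. one with $R=0$: $2N$ is an even number which is a multiple of $n$, $N_0+\cdots+N_r=N$ is a partition of $N$, and $F:\coprod_{j=0}^r\{1,\dots,2N_j\}\to\{1,\dots,2N/n\}$ satisfies $|F^{-1}(i)|=n$ for every $i$. Let $\underline N'=(N_0-1,N_1,\dots,N_r)$ and let $F'$ be the restriction of $F$ to $\{1,\dots,2N_0-2\}\amalg\coprod_{j=1}^r\{1,\dots,2N_j\}$. The set of inputs $(N-1,2,\underline N',F')$ is then also valid, and $(Q^{\underline N',F'})^{b_1b_2}{}_t{}^lW_{b_1b_2}{}^s{}_l=(Q^{\underline N,F})_t{}^s$. The tensor $(Q^{\underline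 N,F})_t{}^s$ is a section of $\mathrm{End}(TM)\otimes(\Lambda^n(T^*M))^{2N/n}$. Let $||Q^{\underline N,F}||$, a section of $(\Lambda^n(T^*M))^{2N}$, be its determinant, and $\widetilde{(Q^{\underline N,F})}_t{}^s$, a section of $\mathrm{End}(TM)\otimes(\Lambda^n(T^*M))^{2N(n-1)/n}$, its pointwise adjugate, so that where $||Q^{\underline N,F}||\ne0$ the inverse is $||Q^{\underline N,F}||^{-1}\widetilde{(Q^{\underline N,F})}$. When $||Q^{\underline N,F}||$ is nowhere zero, set $$D^{ab}{}_i{}^k=D_{(Q)}^{ab}{}_i{}^k:=||Q^{\underline N,F}||^{-1}\widetilde{(Q^{\underline N,F})}_i{}^r(Q^{\underline N',F'})^{ab}{}_r{}^k,$$ which satisfies $D^{ab}{}_i{}^kW_{ab}{}^j{}_k=\delta_i{}^j$. With this $D$ define $$G^{(Q)}_{ij}=P_{ij}+\nabla_i(D^{ab}{}_j{}^cC_{cab})+D^{ab}{}_i{}^cC_{cab}D^{ef}{}_j{}^gC_{gef},$$ $$E^{(Q)}_{ijk}=\nabla_iG^{(Q)}_{jk}+\big(2G^{(Q)}_{jk}D^{ab}{}_i{}^c+G^{(Q)}_{ji}D^{ab}{}_k{}^c+G^{(Q)}_{ik}D^{ab}{}_j{}^c\big)C_{cab},$$ and let $\gamma^{(Q)}$, a section of $(\Lambda^nT^*M)^2$, be $G^{(Q)}_{a_1b_1}G^{(Q)}_{a_2b_2}\cdots G^{(Q)}_{a_nb_n}$ with $a_1,\dots,a_n$ skewed over and $b_1,\dots,b_n$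 skewed over. These tensors depend only on the projective class of $\nabla$. *)

theory Defs
  imports "HOL-Analysis.Analysis"
begin

section \<open>Smooth manifolds\<close>

definition pd :: "'n::finite \<Rightarrow> (real^'n \<Rightarrow> real) \<Rightarrow> real^'n \<Rightarrow> real" where
  "pd i f x = frechet_derivative f (at x) (axis i 1)"

primrec Ck_on :: "nat \<Rightarrow> (real^'n::finite) set \<Rightarrow> (real^'n \<Rightarrow> real) \<Rightarrow> bool" where
  "Ck_on 0 S f = continuous_on S f"
| "Ck_on (Suc k) S f = ((\<forall>x\<in>S. f differentiable (at x)) \<and> (\<forall>i. Ck_on k S (pd i f)))"

text \<open>Only used for open \<open>S\<close>.\<close>
definition smooth_fun :: "(real^'n::finite) set \<Rightarrow> (real^'n \<Rightarrow> real) \<Rightarrow> bool" where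
  "smooth_fun S f \<longleftrightarrow> (\<forall>k. Ck_on k S f)"

text \<open>A chart is a pair \<open>(U, \<phi>)\<close>; the values of \<open>\<phi>\<close> outside \<open>U\<close> are irrelevant.\<close>
type_synonym ('a, 'n) chart = "'a set \<times> ('a \<Rightarrow> real^'n)"

definition cimage :: "('a, 'n::finite) chart \<Rightarrow> (real^'n) set" where
  "cimage c = snd c ` fst c"

definition transition :: "('a, 'n::finite) chart \<Rightarrow> ('a, 'n) chart \<Rightarrow> real^'n \<Rightarrow> real^'n" where
  "transition c c' x = snd c' (inv_into (fst c) (snd c) x)"

definition overlap :: "('a, 'n::finite) chart \<Rightarrow> ('a, 'n) chart \<Rightarrow> (real^'n) set" where
  "overlap c c' = snd c ` (fst c \<inter> fst c')"

definition is_chart :: "'a topology \<Rightarrow> ('a, 'n::finite) chart \<Rightarrow> bool" where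
  "is_chart M c \<longleftrightarrow> openin M (fst c) \<and> open (cimage c) \<and>
     homeomorphic_map (subtopology M (fst c)) (top_of_set (cimage c)) (snd c)"

text \<open>A smooth manifold of dimension \<open>CARD('n)\<close>, given by an atlas (not necessarily maximal).\<close>
definition smooth_manifold :: "'a topology \<Rightarrow> ('a, 'n::finite) chart set \<Rightarrow> bool" where
  "smooth_manifold M A \<longleftrightarrow> Hausdorff_space M \<and> second_countable M \<and>
     (\<forall>c\<in>A. is_chart M c) \<and> (\<Union>c\<in>A. fst c) = topspace M \<and>
     (\<forall>c\<in>A. \<forall>c'\<in>A. \<forall>k. smooth_fun (overlap c c') (\<lambda>x. transition c c' x $ k))"

section \<open>Tensor fields and connections\<close>

text \<open>
  Fields are given by their components in every chart of the atlas, as functions of the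
  coordinates, subject to the transformation laws. With \<open>y = \<tau>(x)\<close> the coordinate change from
  \<open>c\<close> to \<open>c'\<close>, \<open>jac c c' x i a\<close> is \<open>\<partial>y\<^sup>i/\<partial>x\<^sup>a\<close>.
\<close>

definition jac :: "('a, 'n::finite) chart \<Rightarrow> ('a, 'n) chart \<Rightarrow> real^'n \<Rightarrow> 'n \<Rightarrow> 'n \<Rightarrow> real" where
  "jac c c' x i a = pd a (\<lambda>z. transition c c' z $ i) x"

definition one_form ::
  "('a, 'n::finite) chart set \<Rightarrow> (('a, 'n) chart \<Rightarrow> real^'n \<Rightarrow> 'n \<Rightarrow> real) \<Rightarrow> bool" where
  "one_form A u \<longleftrightarrow>
     (\<forall>c\<in>A. \<forall>a. smooth_fun (cimage c) (\<lambda>x. u c x a)) \<and>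
     (\<forall>c\<in>A. \<forall>c'\<in>A. \<forall>x\<in>overlap c c'. \<forall>a.
        u c x a = (\<Sum>i\<in>UNIV. jac c c' x i a * u c' (transition c c' x) i))"

text \<open>A pseudo-Riemannian metric of any signature; nondegeneracy is \<open>det g \<noteq> 0\<close>.\<close>
definition pseudo_riemannian_metric ::
  "('a, 'n::finite) chart set \<Rightarrow> (('a, 'n) chart \<Rightarrow> real^'n \<Rightarrow> 'n \<Rightarrow> 'n \<Rightarrow> real) \<Rightarrow> bool" where
  "pseudo_riemannian_metric A g \<longleftrightarrow>
     (\<forall>c\<in>A. \<forall>a b. smooth_fun (cimage c) (\<lambda>x. g c x a b)) \<and>
     (\<forall>c\<in>A. \<forall>x\<in>cimage c. (\<forall>a b. g c x a b = g c x b a) \<and> det (\<chi> a b. g c x a b) \<noteq> 0) \<and>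
     (\<forall>c\<in>A. \<forall>c'\<in>A. \<forall>x\<in>overlap c c'. \<forall>a b. g c x a b =
        (\<Sum>i\<in>UNIV. \<Sum>j\<in>UNIV. jac c c' x i a * jac c c' x j b * g c' (transition c c' x) i j))"

text \<open>
  A torsion-free affine connection, given by its Christoffel symbols
  \<open>\<Gamma> c x k a b = \<Gamma>\<^sup>k\<^sub>a\<^sub>b\<close>, i.e. \<open>\<nabla>\<^sub>a v\<^sup>k = \<partial>\<^sub>a v\<^sup>k + \<Gamma>\<^sup>k\<^sub>a\<^sub>b v\<^sup>b\<close> in the chart \<open>c\<close>.
\<close>
definition torsion_free_connection ::
  "('a, 'n::finite) chart set \<Rightarrow> (('a, 'n) chart \<Rightarrow> real^'n \<Rightarrow> 'n \<Rightarrow> 'n \<Rightarrow> 'n \<Rightarrow> real) \<Rightarrow> bool" where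
  "torsion_free_connection A \<Gamma> \<longleftrightarrow>
     (\<forall>c\<in>A. \<forall>k a b. smooth_fun (cimage c) (\<lambda>x. \<Gamma> c x k a b)) \<and>
     (\<forall>c\<in>A. \<forall>x\<in>cimage c. \<forall>k a b. \<Gamma> c x k a b = \<Gamma> c x k b a) \<and>
     (\<forall>c\<in>A. \<forall>c'\<in>A. \<forall>x\<in>overlap c c'. \<forall>k a b.
        (\<Sum>l\<in>UNIV. jac c c' x k l * \<Gamma> c x l a b) =
        pd a (\<lambda>z. jac c c' z k b) x +
        (\<Sum>i\<in>UNIV. \<Sum>j\<in>UNIV.
           \<Gamma> c' (transition c c' x) k i j * jac c c' x i a * jac c c' x j b))"

section \<open>Local differential geometry in one chart\<close>

type_synonym 'n cov2 = "real^'n \<Rightarrow> 'n \<Rightarrow> 'n \<Rightarrow> real"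
type_synonym 'n christoffel = "real^'n \<Rightarrow> 'n \<Rightarrow> 'n \<Rightarrow> 'n \<Rightarrow> real"

abbreviation kron :: "'n \<Rightarrow> 'n \<Rightarrow> real" where
  "kron a b \<equiv> (if a = b then 1 else 0)"

text \<open>\<open>\<nabla>\<^sub>a v\<^sup>k\<close>, \<open>\<nabla>\<^sub>a u\<^sub>b\<close>, \<open>\<nabla>\<^sub>a T\<^sub>b\<^sup>k\<close> and \<open>\<nabla>\<^sub>i h\<^sub>j\<^sub>k\<close>, with the index of \<open>\<nabla>\<close> first.\<close>
definition nabla_vec :: "('n::finite) christoffel \<Rightarrow> (real^'n \<Rightarrow> 'n \<Rightarrow> real) \<Rightarrow> real^'n \<Rightarrow> 'n \<Rightarrow> 'n \<Rightarrow> real" where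
  "nabla_vec \<Gamma> v x a k = pd a (\<lambda>y. v y k) x + (\<Sum>l\<in>UNIV. \<Gamma> x k a l * v x l)"

definition nabla1 :: "('n::finite) christoffel \<Rightarrow> (real^'n \<Rightarrow> 'n \<Rightarrow> real) \<Rightarrow> 'n cov2" where
  "nabla1 \<Gamma> u x a b = pd a (\<lambda>y. u y b) x - (\<Sum>l\<in>UNIV. \<Gamma> x l a b * u x l)"

definition nabla_mixed :: "('n::finite) christoffel \<Rightarrow> (real^'n \<Rightarrow> 'n \<Rightarrow> 'n \<Rightarrow> real) \<Rightarrow> real^'n \<Rightarrow> 'n \<Rightarrow> 'n \<Rightarrow> 'n \<Rightarrow> real" where
  "nabla_mixed \<Gamma> T x a b k = pd a (\<lambda>y. T y b k) x
     - (\<Sum>l\<in>UNIV. \<Gamma> x l a b * T x l k) + (\<Sum>l\<in>UNIV. \<Gamma> x k a l * T x b l)"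

definition nabla2 :: "('n::finite) christoffel \<Rightarrow> 'n cov2 \<Rightarrow> real^'n \<Rightarrow> 'n \<Rightarrow> 'n \<Rightarrow> 'n \<Rightarrow> real" where
  "nabla2 \<Gamma> h x i j k = pd i (\<lambda>y. h y j k) x
     - (\<Sum>l\<in>UNIV. \<Gamma> x l i j * h x l k) - (\<Sum>l\<in>UNIV. \<Gamma> x l i k * h x j l)"

text \<open>\<open>curv \<Gamma> x a b c d = R\<^sub>a\<^sub>b\<^sup>c\<^sub>d\<close>; see \<open>ricci_identity\<close> below for the sign convention.\<close>
definition curv :: "('n::finite) christoffel \<Rightarrow> real^'n \<Rightarrow> 'n \<Rightarrow> 'n \<Rightarrow> 'n \<Rightarrow> 'n \<Rightarrow> real" where
  "curv \<Gamma> x a b c d =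
     pd a (\<lambda>y. \<Gamma> y c b d) x - pd b (\<lambda>y. \<Gamma> y c a d) x
     + (\<Sum>e\<in>UNIV. \<Gamma> x c a e * \<Gamma> x e b d) - (\<Sum>e\<in>UNIV. \<Gamma> x c b e * \<Gamma> x e a d)"

text \<open>\<open>(\<nabla>\<^sub>a \<nabla>\<^sub>b - \<nabla>\<^sub>b \<nabla>\<^sub>a) v\<^sup>c = R\<^sub>a\<^sub>b\<^sup>c\<^sub>d v\<^sup>d\<close>\<close>
lemma ricci_identity:
  fixes \<Gamma> :: "('n::finite) christoffel"
  assumes "\<And>k i j. (\<lambda>y. \<Gamma> y k i j) differentiable (at x)"
    and "\<And>k i j. \<Gamma> x k i j = \<Gamma> x k j i"
    and "\<And>k. (\<lambda>y. v y k) differentiable (at x)"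
    and "\<And>k i. pd i (\<lambda>y. v y k) differentiable (at x)"
    and "\<And>k i j. pd i (pd j (\<lambda>y. v y k)) x = pd j (pd i (\<lambda>y. v y k)) x"
  shows "nabla_mixed \<Gamma> (nabla_vec \<Gamma> v) x a b c - nabla_mixed \<Gamma> (nabla_vec \<Gamma> v) x b a c =
         (\<Sum>d\<in>UNIV. curv \<Gamma> x a b c d * v x d)"
proof -
  have hd: "(f has_derivative frechet_derivative f (at x)) (at x)" if "f differentiable (at x)" for f :: "real^'n \<Rightarrow> real"
    using that frechet_derivative_works by blast
  have pdI: "pd i f x = D (axis i 1)" if "(f has_derivative D) (at x)" for i f D
    unfolding pd_def using frechet_derivative_at[OF that] by simp
  have 1: "pd a (\<lambda>y. nabla_vec \<Gamma> v y b c) x = pd a (pd b (\<lambda>y. v y c)) x +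
     (\<Sum>l\<in>UNIV. pd a (\<lambda>y. \<Gamma> y c b l) x * v x l + \<Gamma> x c b l * pd a (\<lambda>y. v y l) x)" for a b c
    unfolding nabla_vec_def
    by (subst pdI, rule derivative_intros, rule hd, rule assms, rule derivative_intros,
        rule has_derivative_mult, rule hd, rule assms, rule hd, rule assms)
       (simp add: pd_def[abs_def] sum.distrib add.commute mult.commute)
  have s: "(\<Sum>l\<in>UNIV. \<Gamma> x l b a * nabla_vec \<Gamma> v x l c) = (\<Sum>l\<in>UNIV. \<Gamma> x l a b * nabla_vec \<Gamma> v x l c)"
    by (simp only: assms(2)[of _ b a])
  have 2: "(\<Sum>l\<in>UNIV. \<Gamma> x c a l * nabla_vec \<Gamma> v x b l) =
      (\<Sum>l\<in>UNIV. \<Gamma> x c a l * pd b (\<lambda>y. v y l) x) + (\<Sum>d\<in>UNIV. (\<Sum>e\<in>UNIV. \<Gamma> x c a e * \<Gamma> x e b d) * v x d)" for a b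
    unfolding nabla_vec_def ring_distribs sum.distrib sum_distrib_left sum_distrib_right
    by (subst (2) sum.swap) (simp only: mult.assoc)
  have 3: "(\<Sum>d\<in>UNIV. curv \<Gamma> x a b c d * v x d) =
      (\<Sum>d\<in>UNIV. pd a (\<lambda>y. \<Gamma> y c b d) x * v x d) - (\<Sum>d\<in>UNIV. pd b (\<lambda>y. \<Gamma> y c a d) x * v x d)
      + (\<Sum>d\<in>UNIV. (\<Sum>e\<in>UNIV. \<Gamma> x c a e * \<Gamma> x e b d) * v x d)
      - (\<Sum>d\<in>UNIV. (\<Sum>e\<in>UNIV. \<Gamma> x c b e * \<Gamma> x e a d) * v x d)"
    unfolding curv_def by (simp only: left_diff_distrib distrib_right sum.distrib sum_subtractf)
  show ?thesis
    unfolding nabla_mixed_def 1 2 3 s assms(5)[of a b] sum.distrib by simp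
qed

definition ric :: "('n::finite) christoffel \<Rightarrow> 'n cov2" where
  "ric \<Gamma> x a b = (\<Sum>c\<in>UNIV. curv \<Gamma> x c a c b)"

text \<open>
  \<open>\<beta>\<close>, \<open>P\<close> and \<open>W\<close> solve the decomposition
  \<open>R\<^sub>a\<^sub>b\<^sup>c\<^sub>d = W\<^sub>a\<^sub>b\<^sup>c\<^sub>d + \<delta>\<^sup>c\<^sub>a P\<^sub>b\<^sub>d - \<delta>\<^sup>c\<^sub>b P\<^sub>a\<^sub>d + \<beta>\<^sub>a\<^sub>b \<delta>\<^sup>c\<^sub>d\<close> with \<open>W\<close> completely trace-free and
  \<open>\<beta>\<^sub>a\<^sub>b = P\<^sub>b\<^sub>a - P\<^sub>a\<^sub>b\<close>; \<open>curvature_decomposition\<close> below shows that the solution is unique.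
\<close>
definition beta :: "('n::finite) christoffel \<Rightarrow> 'n cov2" where
  "beta \<Gamma> x a b = (ric \<Gamma> x b a - ric \<Gamma> x a b) / (real CARD('n) + 1)"

definition schouten :: "('n::finite) christoffel \<Rightarrow> 'n cov2" where
  "schouten \<Gamma> x a b = (ric \<Gamma> x a b + beta \<Gamma> x a b) / (real CARD('n) - 1)"

definition weyl :: "('n::finite) christoffel \<Rightarrow> real^'n \<Rightarrow> 'n \<Rightarrow> 'n \<Rightarrow> 'n \<Rightarrow> 'n \<Rightarrow> real" where
  "weyl \<Gamma> x a b c d = curv \<Gamma> x a b c d
     - (kron c a * schouten \<Gamma> x b d - kron c b * schouten \<Gamma> x a d) - beta \<Gamma> x a b * kron c d"

text \<open>\<open>cotton \<Gamma> x d a b = C\<^sub>d\<^sub>a\<^sub>b = \<nabla>\<^sub>a P\<^sub>b\<^sub>d - \<nabla>\<^sub>b P\<^sub>a\<^sub>d\<close>.\<close>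
definition cotton :: "('n::finite) christoffel \<Rightarrow> real^'n \<Rightarrow> 'n \<Rightarrow> 'n \<Rightarrow> 'n \<Rightarrow> real" where
  "cotton \<Gamma> x d a b = nabla2 \<Gamma> (schouten \<Gamma>) x a b d - nabla2 \<Gamma> (schouten \<Gamma>) x b a d"

lemma kron_sums:
  fixes f :: "'n::finite \<Rightarrow> real"
  shows "(\<Sum>c\<in>UNIV. kron c a * f c) = f a" "(\<Sum>c\<in>UNIV. kron a c * f c) = f a"
    "(\<Sum>c\<in>UNIV. f c * kron c a) = f a" "(\<Sum>c\<in>UNIV. f c * kron a c) = f a"
proof -
  have "kron c a * f c = (if c = a then f c else 0)" "kron a c * f c = (if c = a then f c else 0)" for c by auto
  thus "(\<Sum>c\<in>UNIV. kron c a * f c) = f a" "(\<Sum>c\<in>UNIV. kron a c * f c) = f a"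
    by (simp_all only: sum.delta finite UNIV_I if_True)
  thus "(\<Sum>c\<in>UNIV. f c * kron c a) = f a" "(\<Sum>c\<in>UNIV. f c * kron a c) = f a"
    by (simp_all only: mult.commute)
qed

lemma curv_skew: "curv \<Gamma> x b a c d = - curv \<Gamma> x a b c d"
  by (simp add: curv_def)

lemma curv_bianchi:
  assumes "open S" "x \<in> S" "\<And>y k a b. y \<in> S \<Longrightarrow> \<Gamma> y k a b = \<Gamma> y k b a"
  shows "curv \<Gamma> x a b c d + curv \<Gamma> x b d c a + curv \<Gamma> x d a c b = 0"
proof -
  have "pd i (\<lambda>y. \<Gamma> y k a b) x = pd i (\<lambda>y. \<Gamma> y k b a) x" for i k a b
  proof -
    have "((\<lambda>y. \<Gamma> y k a b) has_derivative D) (at x) \<longleftrightarrow> ((\<lambda>y. \<Gamma> y k b a) has_derivative D) (at x)" for D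
      using has_derivative_transform_within_open[OF _ assms(1,2), of "\<lambda>y. \<Gamma> y k a b" D UNIV "\<lambda>y. \<Gamma> y k b a"]
        has_derivative_transform_within_open[OF _ assms(1,2), of "\<lambda>y. \<Gamma> y k b a" D UNIV "\<lambda>y. \<Gamma> y k a b"]
        assms(3)[of _ k a b] by auto
    thus ?thesis by (simp add: pd_def frechet_derivative_def)
  qed
  note * = this[of d c a b] this[of a c b d] this[of b c a d]
  have s: "\<Gamma> x e a b = \<Gamma> x e b a" "\<Gamma> x e d b = \<Gamma> x e b d" "\<Gamma> x e d a = \<Gamma> x e a d" for e
    using assms(3)[OF assms(2)] by blast+
  show ?thesis
    unfolding curv_def * s by simp
qed

lemma curv_trace:
  assumes "open S" "x \<in> S" "\<And>y k a b. y \<in> S \<Longrightarrow> \<Gamma> y k a b = \<Gamma> y k b a"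
  shows "(\<Sum>c\<in>UNIV. curv \<Gamma> x a b c c) = ric \<Gamma> x b a - ric \<Gamma> x a b"
proof -
  have "curv \<Gamma> x a b c c = curv \<Gamma> x c b c a - curv \<Gamma> x c a c b" for c
    using curv_bianchi[of S x \<Gamma> a b c c, OF assms] curv_skew[of \<Gamma> x b c c a] by simp
  thus ?thesis by (simp add: ric_def sum_subtractf)
qed

lemma curvature_decomposition:
  fixes \<Gamma> :: "('n::finite) christoffel"
  assumes "CARD('n) \<ge> 2" "open S" "x \<in> S" "\<And>y k a b. y \<in> S \<Longrightarrow> \<Gamma> y k a b = \<Gamma> y k b a"
  shows "(\<forall>a b c d. curv \<Gamma> x a b c d =
             W a b c d + (kron c a * P b d - kron c b * P a d) + B a b * kron c d) \<and>
         (\<forall>a b. B a b = P b a - P a b) \<and>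
         (\<forall>a b. (\<Sum>c\<in>UNIV. W c a c b) = 0 \<and> (\<Sum>c\<in>UNIV. W a c c b) = 0 \<and> (\<Sum>c\<in>UNIV. W a b c c) = 0)
     \<longleftrightarrow> W = weyl \<Gamma> x \<and> P = schouten \<Gamma> x \<and> B = beta \<Gamma> x" (is "?l \<longleftrightarrow> ?r")
proof -
  define n where "n = real CARD('n)"
  have n: "n \<ge> 2" using assms(1) by (simp add: n_def)
  note tr = curv_trace[OF assms(2-4), simplified]
  have beta: "beta \<Gamma> x a b = schouten \<Gamma> x b a - schouten \<Gamma> x a b" for a b
  proof -
    define p q where "p = ric \<Gamma> x a b" and "q = ric \<Gamma> x b a"
    have "(q - p) / (n+1) = (q + (p - q)/(n+1)) / (n-1) - (p + (q - p)/(n+1)) / (n-1)"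
      using n by (simp add: divide_simps) (simp add: algebra_simps)
    thus ?thesis by (simp add: schouten_def beta_def n_def p_def q_def)
  qed
  have one: "(\<Sum>c\<in>UNIV. kron c (c::'n) * f) = n * f" for f by (simp add: n_def)
  show ?thesis
  proof
    assume l: ?l
    have R: "curv \<Gamma> x a b c d =
             W a b c d + (kron c a * P b d - kron c b * P a d) + B a b * kron c d" for a b c d using l by blast
    have B: "B a b = P b a - P a b" for a b using l by blast
    have ric: "ric \<Gamma> x a b = (n - 1) * P a b - B a b" for a b
    proof -
      have "ric \<Gamma> x a b = (\<Sum>c\<in>UNIV. W c a c b) + (\<Sum>c\<in>UNIV. kron c (c::'n) * P a b)
         - (\<Sum>c\<in>UNIV. kron c a * P c b) + (\<Sum>c\<in>UNIV. B c a * kron c b)"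
        unfolding ric_def R by (simp only: sum.distrib sum_subtractf)
      thus ?thesis using l unfolding kron_sums one by (simp add: B algebra_simps)
    qed
    have Bb: "B a b = beta \<Gamma> x a b" for a b
    proof -
      have "(n + 1) * B a b = ric \<Gamma> x b a - ric \<Gamma> x a b" by (simp add: ric B algebra_simps)
      moreover have "n + 1 \<noteq> 0" using n by simp
      ultimately show ?thesis unfolding beta_def n_def[symmetric] by (simp add: nonzero_eq_divide_eq mult.commute)
    qed
    have Ps: "P a b = schouten \<Gamma> x a b" for a b
      using n ric[of a b] unfolding schouten_def n_def[symmetric] Bb[symmetric] by simp
    have "W a b c d = weyl \<Gamma> x a b c d" for a b c d
      using R[of a b c d] unfolding weyl_def Bb Ps by linarith
    thus ?r using Bb Ps by (auto simp: fun_eq_iff)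
  next
    assume r: ?r
    have "(\<Sum>c\<in>UNIV. weyl \<Gamma> x c a c b) = 0" for a b
    proof -
      have "(\<Sum>c\<in>UNIV. weyl \<Gamma> x c a c b) = ric \<Gamma> x a b - ((\<Sum>c\<in>UNIV. kron c (c::'n) * schouten \<Gamma> x a b)
         - (\<Sum>c\<in>UNIV. kron c a * schouten \<Gamma> x c b)) - (\<Sum>c\<in>UNIV. beta \<Gamma> x c a * kron c b)"
        unfolding ric_def weyl_def by (simp only: sum.distrib sum_subtractf)
      also have "\<dots> = ric \<Gamma> x a b - (n - 1) * schouten \<Gamma> x a b + beta \<Gamma> x a b"
        unfolding kron_sums one by (simp add: beta algebra_simps)
      also have "\<dots> = 0" using n unfolding schouten_def n_def[symmetric] by simp
      finally show ?thesis .
    qed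
    moreover have "weyl \<Gamma> x a c c b = - weyl \<Gamma> x c a c b" for a b c
      using curv_skew[of \<Gamma> x a c c b] by (simp add: weyl_def beta algebra_simps)
    moreover have "(\<Sum>c\<in>UNIV. weyl \<Gamma> x a b c c) = 0" for a b
    proof -
      have "(\<Sum>c\<in>UNIV. weyl \<Gamma> x a b c c) = (\<Sum>c\<in>UNIV. curv \<Gamma> x a b c c) -
         ((\<Sum>c\<in>UNIV. kron c a * schouten \<Gamma> x b c) - (\<Sum>c\<in>UNIV. kron c b * schouten \<Gamma> x a c))
         - (\<Sum>c\<in>UNIV. kron c (c::'n) * beta \<Gamma> x a b)"
        unfolding weyl_def by (simp add: sum.distrib sum_subtractf)
      also have "\<dots> = ric \<Gamma> x b a - ric \<Gamma> x a b - (n + 1) * beta \<Gamma> x a b"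
        unfolding kron_sums one by (simp add: beta tr algebra_simps)
      also have "\<dots> = 0" using n unfolding beta_def n_def[symmetric] by simp
      finally show ?thesis .
    qed
    ultimately have t: "\<forall>a b. (\<Sum>c\<in>UNIV. weyl \<Gamma> x c a c b) = 0 \<and>
        (\<Sum>c\<in>UNIV. weyl \<Gamma> x a c c b) = 0 \<and> (\<Sum>c\<in>UNIV. weyl \<Gamma> x a b c c) = 0"
      by (simp only: sum_negf minus_zero simp_thms)
    have d: "\<forall>a b c d. curv \<Gamma> x a b c d = weyl \<Gamma> x a b c d
        + (kron c a * schouten \<Gamma> x b d - kron c b * schouten \<Gamma> x a d) + beta \<Gamma> x a b * kron c d"
      by (simp only: weyl_def) simp
    show ?l using r t d beta by blast
  qed
qed



definition ricci_flat ::
  "('a, 'n::finite) chart set \<Rightarrow> (('a, 'n) chart \<Rightarrow> 'n christoffel) \<Rightarrow> bool" where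
  "ricci_flat A \<Gamma> \<longleftrightarrow> (\<forall>c\<in>A. \<forall>x\<in>cimage c. \<forall>a b. ric (\<Gamma> c) x a b = 0)"

text \<open>The identity is imposed on all 1-forms \<open>u\<close> on chart domains.\<close>
definition projectively_equivalent ::
  "('a, 'n::finite) chart set \<Rightarrow> (('a, 'n) chart \<Rightarrow> 'n christoffel) \<Rightarrow>
   (('a, 'n) chart \<Rightarrow> 'n christoffel) \<Rightarrow> bool" where
  "projectively_equivalent A \<Gamma> \<Gamma>' \<longleftrightarrow>
     (\<exists>\<Upsilon>. one_form A \<Upsilon> \<and>
        (\<forall>c\<in>A. \<forall>u. (\<forall>b. smooth_fun (cimage c) (\<lambda>x. u x b)) \<longrightarrow>
           (\<forall>x\<in>cimage c. \<forall>a b.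
              nabla1 (\<Gamma>' c) u x a b = nabla1 (\<Gamma> c) u x a b - \<Upsilon> c x a * u x b - \<Upsilon> c x b * u x a)))"

definition levi_civita ::
  "('a, 'n::finite) chart set \<Rightarrow> (('a, 'n) chart \<Rightarrow> 'n cov2) \<Rightarrow>
   (('a, 'n) chart \<Rightarrow> 'n christoffel) \<Rightarrow> bool" where
  "levi_civita A g \<Gamma> \<longleftrightarrow> torsion_free_connection A \<Gamma> \<and>
     (\<forall>c\<in>A. \<forall>x\<in>cimage c. \<forall>i j k. nabla2 (\<Gamma> c) (g c) x i j k = 0)"

text \<open>\<open>K\<close> is the Einstein constant; \<open>\<Gamma>\<close> is meant to be the Levi-Civita connection of \<open>g\<close>.\<close>
definition einstein ::
  "('a, 'n::finite) chart set \<Rightarrow> (('a, 'n) chart \<Rightarrow> 'n cov2) \<Rightarrow>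
   (('a, 'n) chart \<Rightarrow> 'n christoffel) \<Rightarrow> real \<Rightarrow> bool" where
  "einstein A g \<Gamma> K \<longleftrightarrow> (\<forall>c\<in>A. \<forall>x\<in>cimage c. \<forall>a b. ric (\<Gamma> c) x a b = K * g c x a b)"

section \<open>The tensor \<open>Q\<close>\<close>

text \<open>The disjoint union of the sets \<open>{1..2 * Nf j}\<close>, \<open>j = 0, \<dots>, r\<close>.\<close>
definition slots :: "nat \<Rightarrow> (nat \<Rightarrow> nat) \<Rightarrow> (nat \<times> nat) set" where
  "slots r Nf = (SIGMA j:{0..r}. {1..2 * Nf j})"

text \<open>
  \<open>n\<close> is the dimension, \<open>Nf 0 + \<dots> + Nf r = N\<close> the partition. Parts may be \<open>0\<close>.
\<close>
definition valid_inputs ::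
  "nat \<Rightarrow> nat \<Rightarrow> nat \<Rightarrow> nat \<Rightarrow> (nat \<Rightarrow> nat) \<Rightarrow> (nat \<times> nat \<Rightarrow> nat) \<Rightarrow> bool" where
  "valid_inputs n N R r Nf F \<longleftrightarrow>
     R < n \<and> n dvd 2 * N + R \<and> (\<Sum>j=0..r. Nf j) = N \<and>
     F ` slots r Nf \<subseteq> {1..(2 * N + R) div n} \<and>
     (\<forall>i\<in>{2..(2 * N + R) div n}. card {p \<in> slots r Nf. F p = i} = n) \<and>
     card {p \<in> slots r Nf. F p = 1} = n - R"

text \<open>
  The component \<open>\<epsilon>\<^sup>a\<^sup>1\<^sup>\<dots>\<^sup>a\<^sup>n\<close> of the tautological section of \<open>\<Lambda>\<^sup>n(TM) \<otimes> \<Lambda>\<^sup>n(T\<^sup>*M)\<close> in the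
  trivialisation of \<open>\<Lambda>\<^sup>n(T\<^sup>*M)\<close> by the coordinates: the determinant of the matrix whose rows are
  the standard basis vectors \<open>e\<^sub>a\<^sub>1, \<dots>, e\<^sub>a\<^sub>n\<close>. The list must have length \<open>n\<close>; the linear
  order on \<open>'n\<close> only serves to enumerate the rows.
\<close>
definition levi :: "('n::{finite,linorder}) list \<Rightarrow> real" where
  "levi l = det (\<chi> i j. kron (l ! card {k. k < i}) (j::'n))"

text \<open>
  \<open>wpow W k a s t\<close> is \<open>(P\<^sup>k)\<^sub>a\<^sub>1\<^sub>\<dots>\<^sub>a\<^sub>2\<^sub>k\<^sup>s\<^sub>t\<close>, with \<open>a\<close> indexed from \<open>1\<close>.
\<close>
primrec wpow :: "(('n::finite) \<Rightarrow> 'n \<Rightarrow> 'n \<Rightarrow> 'n \<Rightarrow> real) \<Rightarrow> nat \<Rightarrow> (nat \<Rightarrow> 'n) \<Rightarrow> 'n \<Rightarrow> 'n \<Rightarrow> real" where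
  "wpow W 0 a s t = kron s t"
| "wpow W (Suc k) a s t = (\<Sum>l\<in>UNIV. wpow W k a l t * W (a (2 * k + 1)) (a (2 * k + 2)) s l)"

text \<open>
  The slots of the \<open>i\<close>-th skewing group, in a fixed order: the slots of the traced factors
  \<open>j = 1, \<dots>, r\<close> first, those of the untraced factor \<open>j = 0\<close> last.
\<close>
definition group :: "nat \<Rightarrow> (nat \<Rightarrow> nat) \<Rightarrow> (nat \<times> nat \<Rightarrow> nat) \<Rightarrow> nat \<Rightarrow> (nat \<times> nat) list" where
  "group r Nf F i =
     filter (\<lambda>p. F p = i) [(j, \<alpha>). j \<leftarrow> [1..<Suc r] @ [0], \<alpha> \<leftarrow> [1..<Suc (2 * Nf j)]]"

text \<open>
  \<open>Qten W r Nf F bs t s\<close> is \<open>(Q\<^sup>N\<^sup>,\<^sup>F)\<^sup>b\<^sup>1\<^sup>\<dots>\<^sup>b\<^sup>R\<^sub>t\<^sup>s\<close> at a point, \<open>W\<close> being the Weyl tensor there.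
  Contracting the slots of each group with \<open>1/n! \<epsilon>\<close> skews over them and, if the group is full,
  yields the coefficient of the resulting \<open>n\<close>-form; if \<open>R\<close> slots of the group are missing, the
  last \<open>R\<close> indices of \<open>\<epsilon>\<close> stay free, which is the isomorphism
  \<open>\<Lambda>\<^sup>n\<^sup>-\<^sup>R(T\<^sup>*M) \<cong> \<Lambda>\<^sup>R(TM) \<otimes> \<Lambda>\<^sup>n(T\<^sup>*M)\<close>. Using the same constant \<open>1/n!\<close> for every \<open>R\<close> is
  the normalisation under which \<open>Q'\<^sup>b\<^sup>1\<^sup>b\<^sup>2\<^sub>t\<^sup>l W\<^sub>b\<^sub>1\<^sub>b\<^sub>2\<^sup>s\<^sub>l = Q\<^sub>t\<^sup>s\<close> holds
  (see \<open>Q_Weyl_contraction\<close> below).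

  The free indices come as a list \<open>bs\<close> of pairs (group, index). For a valid set of inputs
  \<open>(N, R, Nf, F)\<close> this list is \<open>[(1, b\<^sub>1), \<dots>, (1, b\<^sub>R)]\<close>, since group \<open>1\<close> is the one
  with \<open>n - R\<close> slots.
\<close>
definition Qten ::
  "(('n::{finite,linorder}) \<Rightarrow> 'n \<Rightarrow> 'n \<Rightarrow> 'n \<Rightarrow> real) \<Rightarrow> nat \<Rightarrow> (nat \<Rightarrow> nat) \<Rightarrow> (nat \<times> nat \<Rightarrow> nat) \<Rightarrow>
   (nat \<times> 'n) list \<Rightarrow> 'n \<Rightarrow> 'n \<Rightarrow> real" where
  "Qten W r Nf F bs t s =
     (\<Sum>a \<in> slots r Nf \<rightarrow>\<^sub>E UNIV.
        (\<Prod>i = 1..(2 * (\<Sum>j=0..r. Nf j) + length bs) div CARD('n).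
            levi (map a (group r Nf F i) @ map snd (filter (\<lambda>q. fst q = i) bs)) / fact CARD('n))
        * wpow W (Nf 0) (\<lambda>\<alpha>. a (0, \<alpha>)) s t
        * (\<Prod>j = 1..r. \<Sum>c\<in>UNIV. wpow W (Nf j) (\<lambda>\<alpha>. a (j, \<alpha>)) c c))"

text \<open>\<open>(Q\<^sup>N\<^sup>,\<^sup>F)\<^sub>t\<^sup>s\<close> for \<open>R = 0\<close>, as a matrix with row \<open>t\<close> and column \<open>s\<close>.\<close>
definition Qmat ::
  "(('n::{finite,linorder}) \<Rightarrow> 'n \<Rightarrow> 'n \<Rightarrow> 'n \<Rightarrow> real) \<Rightarrow> nat \<Rightarrow> (nat \<Rightarrow> nat) \<Rightarrow> (nat \<times> nat \<Rightarrow> nat) \<Rightarrow>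
   real^('n::{finite,linorder})^('n::{finite,linorder})" where
  "Qmat W r Nf F = (\<chi> t s. Qten W r Nf F [] t s)"

text \<open>
  \<open>(Q\<^sup>N\<^sup>'\<^sup>,\<^sup>F\<^sup>')\<^sup>a\<^sup>b\<^sub>r\<^sup>k\<close>: the part \<open>Nf 0\<close> is lowered by one, and \<open>F\<close> is only used on the remaining
  slots. The two free indices belong to the groups that have lost the slots \<open>2 * Nf 0 - 1\<close> and
  \<open>2 * Nf 0\<close> of the untraced factor. Validity of \<open>(N - 1, 2, N', F')\<close> forces both groups to be
  group \<open>1\<close>; this definition also makes sense for the other valid \<open>(N, 0, Nf, F)\<close>.
\<close>
definition Qprime ::
  "(('n::{finite,linorder}) \<Rightarrow> 'n \<Rightarrow> 'n \<Rightarrow> 'n \<Rightarrow> real) \<Rightarrow> nat \<Rightarrow> (nat \<Rightarrow> nat) \<Rightarrow> (nat \<times> nat \<Rightarrow> nat) \<Rightarrow>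
   'n \<Rightarrow> 'n \<Rightarrow> 'n \<Rightarrow> 'n \<Rightarrow> real" where
  "Qprime W r Nf F a b t s =
     Qten W r (Nf(0 := Nf 0 - 1)) F [(F (0, 2 * Nf 0 - 1), a), (F (0, 2 * Nf 0), b)] t s"

text \<open>The transposed cofactor matrix: the cofactor of the entry \<open>(j, i)\<close> is the determinant of
  \<open>B\<close> with column \<open>i\<close> replaced by \<open>e\<^sub>j\<close>.\<close>
definition adjugate :: "real^('n::finite)^'n \<Rightarrow> real^'n^'n" where
  "adjugate B = (\<chi> i j. det (\<chi> k l. if l = i then kron k j else B $ k $ l))"

lemma adjugate_inverse:
  assumes "det B \<noteq> 0"
  shows "(inverse (det B) *\<^sub>R adjugate B) ** B = mat 1"
    and "B ** (inverse (det B) *\<^sub>R adjugate B) = mat 1"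
proof -
  obtain C where C: "B ** C = mat 1" "C ** B = mat 1"
    using assms by (auto simp: invertible_det_nz[symmetric] invertible_def)
  have "adjugate B $ i $ j = det B * C $ i $ j" for i j
  proof -
    have "B *v (C *v axis j 1) = axis j 1"
      by (simp add: matrix_vector_mul_assoc C)
    from cramer_lemma[of i B "C *v axis j 1", unfolded this]
    have "(C *v axis j 1) $ i * det B = det (\<chi> k l. if l = i then axis j 1 $ k else B $ k $ l)" ..
    also have "\<dots> = adjugate B $ i $ j"
      by (simp add: adjugate_def axis_def cong: if_cong)
    finally show ?thesis by (simp add: matrix_vector_mult_basis column_def mult.commute)
  qed
  hence "inverse (det B) *\<^sub>R adjugate B = C" using assms by (simp add: vec_eq_iff)
  thus "(inverse (det B) *\<^sub>R adjugate B) ** B = mat 1"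
    and "B ** (inverse (det B) *\<^sub>R adjugate B) = mat 1" using C by simp_all
qed

lemma sum_PiE_insert:
  fixes f :: "('b \<Rightarrow> 'c::finite) \<Rightarrow> real"
  assumes "p \<notin> S"
  shows "(\<Sum>a\<in>insert p S \<rightarrow>\<^sub>E UNIV. f a) = (\<Sum>y\<in>UNIV. \<Sum>g\<in>S \<rightarrow>\<^sub>E UNIV. f (g(p := y)))"
proof -
  have "(\<Sum>a\<in>insert p S \<rightarrow>\<^sub>E UNIV. f a) = (\<Sum>z\<in>UNIV \<times> (S \<rightarrow>\<^sub>E UNIV). f ((\<lambda>(y,g). g(p := y)) z))"
    unfolding PiE_insert_eq by (rule sum.reindex[unfolded comp_def]) (rule inj_combinator[OF assms])
  also have "\<dots> = (\<Sum>y\<in>UNIV. \<Sum>g\<in>S \<rightarrow>\<^sub>E UNIV. f (g(p := y)))"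
    by (simp add: sum.cartesian_product case_prod_unfold)
  finally show ?thesis .
qed

lemma wpow_cong: "(\<And>\<alpha>. 1 \<le> \<alpha> \<Longrightarrow> \<alpha> \<le> 2 * k \<Longrightarrow> a \<alpha> = b \<alpha>) \<Longrightarrow> wpow W k a s t = wpow W k b s t"
  by (induction k arbitrary: s) auto

lemma Q_Weyl_contraction:
  fixes W :: "'n::{finite,linorder} \<Rightarrow> 'n \<Rightarrow> 'n \<Rightarrow> 'n \<Rightarrow> real"
  assumes "Nf 0 \<ge> 1"
  shows "(\<Sum>b1\<in>UNIV. \<Sum>b2\<in>UNIV. \<Sum>l\<in>UNIV. Qprime W r Nf F b1 b2 t l * W b1 b2 s l) = Qmat W r Nf F $ t $ s"
proof -
  obtain k where k: "Nf 0 = Suc k" using assms by (cases "Nf 0") auto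
  define Nf' where "Nf' = Nf(0 := k)"
  define p q where "p = (0::nat, 2 * k + 1)" and "q = (0::nat, 2 * k + 2)"
  define m where "m = (2 * (\<Sum>j=0..r. Nf j)) div CARD('n)"
  have sN: "(\<Sum>j=0..r. Nf j) = (\<Sum>j=0..r. Nf' j) + 1"
    by (simp add: sum.atLeast_Suc_atMost Nf'_def k)
  have sl: "slots r Nf = insert q (insert p (slots r Nf'))"
    by (auto simp: slots_def Nf'_def k p_def q_def split: if_splits)
  have notin: "p \<notin> slots r Nf'" "q \<notin> insert p (slots r Nf')"
    by (auto simp: slots_def Nf'_def p_def q_def)
  have grp: "group r Nf F i = group r Nf' F i @ filter (\<lambda>p. F p = i) [p, q]" for i
  proof -
    have "[(j, \<alpha>). j \<leftarrow> [1..<Suc r], \<alpha> \<leftarrow> [1..<Suc (2 * Nf j)]] = [(j, \<alpha>). j \<leftarrow> [1..<Suc r], \<alpha> \<leftarrow> [1..<Suc (2 * Nf' j)]]"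
      by (rule arg_cong[of _ _ concat]) (auto simp: Nf'_def)
    thus ?thesis by (simp add: group_def p_def q_def k Nf'_def)
  qed
  have gs: "set (group r Nf' F i) \<subseteq> slots r Nf'" for i
    by (auto simp: group_def slots_def)
  have bs: "map snd (filter (\<lambda>q. fst q = i) [(F p, a), (F q, b)]) = map (g(p := a, q := b)) (filter (\<lambda>p. F p = i) [p, q])" for i and a b :: 'n and g
    by (auto simp: p_def q_def)
  define T where "T (g :: nat \<times> nat \<Rightarrow> 'n) t s = wpow W k (\<lambda>\<alpha>. g (0, \<alpha>)) s t" for g t s
  define E where "E (g :: nat \<times> nat \<Rightarrow> 'n) = (\<Prod>i=1..m. levi (map g (group r Nf F i)) / fact CARD('n)) *
     (\<Prod>j = 1..r. \<Sum>c\<in>UNIV. wpow W (Nf j) (\<lambda>\<alpha>. g (j, \<alpha>)) c c)" for g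
  have Q: "Qmat W r Nf F $ t $ s = (\<Sum>y\<in>UNIV. \<Sum>z\<in>UNIV. \<Sum>g\<in>slots r Nf' \<rightarrow>\<^sub>E UNIV. 
      E (g(p := z, q := y)) * (\<Sum>l\<in>UNIV. T g t l * W z y s l))"
  proof -
    have w: "wpow W (Suc k) (\<lambda>\<alpha>. (g(p := z, q := y)) (0, \<alpha>)) s t = (\<Sum>l\<in>UNIV. T g t l * W z y s l)" for g y z
      unfolding wpow.simps T_def
      by (intro sum.cong refl arg_cong2[of _ _ _ _ "(*)"] wpow_cong) (auto simp: p_def q_def)
    have "Qmat W r Nf F $ t $ s = (\<Sum>a\<in>slots r Nf \<rightarrow>\<^sub>E UNIV. E a * wpow W (Suc k) (\<lambda>\<alpha>. a (0, \<alpha>)) s t)"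
      by (simp add: Qmat_def Qten_def E_def m_def k mult_ac del: wpow.simps)
    also have "\<dots> = (\<Sum>y\<in>UNIV. \<Sum>z\<in>UNIV. \<Sum>g\<in>slots r Nf' \<rightarrow>\<^sub>E UNIV. 
      E (g(p := z, q := y)) * wpow W (Suc k) (\<lambda>\<alpha>. (g(p := z, q := y)) (0, \<alpha>)) s t)"
      unfolding sl by (simp only: sum_PiE_insert notin not_False_eq_True)
    finally show ?thesis unfolding w .
  qed
  have Q': "Qprime W r Nf F z y t l = (\<Sum>g\<in>slots r Nf' \<rightarrow>\<^sub>E UNIV. E (g(p := z, q := y)) * T g t l)" for y z l
  proof -
    have "Nf(0 := Nf 0 - 1) = Nf'" "2 * (\<Sum>j=0..r. Nf' j) + length [(F p, z), (F q, y)] = 2 * (\<Sum>j=0..r. Nf j)"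
      by (simp_all add: Nf'_def k sN)
    hence "Qprime W r Nf F z y t l = (\<Sum>g\<in>slots r Nf' \<rightarrow>\<^sub>E UNIV. 
       (\<Prod>i = 1..m. levi (map g (group r Nf' F i) @ map (g(p := z, q := y)) (filter (\<lambda>p. F p = i) [p, q])) / fact CARD('n))
        * T g t l * (\<Prod>j = 1..r. \<Sum>c\<in>UNIV. wpow W (Nf' j) (\<lambda>\<alpha>. g (j, \<alpha>)) c c))"
      unfolding Qprime_def Qten_def bs[symmetric] m_def T_def
      by (simp add: Nf'_def k p_def q_def)
    also have "\<dots> = (\<Sum>g\<in>slots r Nf' \<rightarrow>\<^sub>E UNIV. E (g(p := z, q := y)) * T g t l)"
    proof (intro sum.cong refl)
      fix g
      have w1: "map g (group r Nf' F i) = map (g(p := z, q := y)) (group r Nf' F i)" for i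
        using gs[of i] notin by (auto simp: fun_upd_def)
      have w2: "wpow W (Nf' j) (\<lambda>\<alpha>. g (j, \<alpha>)) c c = wpow W (Nf j) (\<lambda>\<alpha>. (g(p := z, q := y)) (j, \<alpha>)) c c" if "j \<in> {1..r}" for j c
        using that by (simp add: Nf'_def p_def q_def)
      have w3: "(\<Prod>j = 1..r. \<Sum>c\<in>UNIV. wpow W (Nf' j) (\<lambda>\<alpha>. g (j, \<alpha>)) c c) =
          (\<Prod>j = 1..r. \<Sum>c\<in>UNIV. wpow W (Nf j) (\<lambda>\<alpha>. (g(p := z, q := y)) (j, \<alpha>)) c c)"
        by (intro prod.cong sum.cong refl) (rule w2)
      show "(\<Prod>i = 1..m. levi (map g (group r Nf' F i) @ map (g(p := z, q := y)) (filter (\<lambda>p. F p = i) [p, q])) / fact CARD('n))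
        * T g t l * (\<Prod>j = 1..r. \<Sum>c\<in>UNIV. wpow W (Nf' j) (\<lambda>\<alpha>. g (j, \<alpha>)) c c) = E (g(p := z, q := y)) * T g t l"
        unfolding E_def grp map_append w1[symmetric] w3 by (simp only: mult_ac)
    qed
    finally show ?thesis .
  qed
  have "(\<Sum>z\<in>UNIV. \<Sum>y\<in>UNIV. \<Sum>l\<in>UNIV. Qprime W r Nf F z y t l * W z y s l) =
     (\<Sum>z\<in>UNIV. \<Sum>y\<in>UNIV. \<Sum>g\<in>slots r Nf' \<rightarrow>\<^sub>E UNIV. E (g(p := z, q := y)) * (\<Sum>l\<in>UNIV. T g t l * W z y s l))"
    unfolding Q' sum_distrib_right sum_distrib_left
    by (intro sum.cong refl, subst sum.swap) (simp add: mult_ac)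
  also have "\<dots> = Qmat W r Nf F $ t $ s"
    unfolding Q by (rule sum.swap)
  finally show ?thesis .
qed

section \<open>The projective invariants\<close>

text \<open>\<open>Dten W r Nf F a b i k = D\<^sup>a\<^sup>b\<^sub>i\<^sup>k\<close>.\<close>
definition Dten ::
  "(('n::{finite,linorder}) \<Rightarrow> 'n \<Rightarrow> 'n \<Rightarrow> 'n \<Rightarrow> real) \<Rightarrow> nat \<Rightarrow> (nat \<Rightarrow> nat) \<Rightarrow> (nat \<times> nat \<Rightarrow> nat) \<Rightarrow>
   'n \<Rightarrow> 'n \<Rightarrow> 'n \<Rightarrow> 'n \<Rightarrow> real" where
  "Dten W r Nf F a b i k =
     inverse (det (Qmat W r Nf F)) *
     (\<Sum>t\<in>UNIV. adjugate (Qmat W r Nf F) $ i $ t * Qprime W r Nf F a b t k)"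

lemma D_Weyl_contraction:
  fixes W :: "'n::{finite,linorder} \<Rightarrow> 'n \<Rightarrow> 'n \<Rightarrow> 'n \<Rightarrow> real"
  assumes "(Nf::nat\<Rightarrow>nat) 0 \<ge> 1" "det (Qmat W r Nf F) \<noteq> 0"
  shows "(\<Sum>a\<in>UNIV. \<Sum>b\<in>UNIV. \<Sum>k\<in>UNIV. Dten W r Nf F a b i k * W a b j k) = kron i j"
proof -
  let ?Q = "Qmat W r Nf F"
  let ?I = "inverse (det ?Q) *\<^sub>R adjugate ?Q"
  have "Dten W r Nf F a b i k = (\<Sum>t\<in>UNIV. ?I $ i $ t * Qprime W r Nf F a b t k)" for a b k
    by (simp add: Dten_def sum_distrib_left mult_ac)
  hence "(\<Sum>a\<in>UNIV. \<Sum>b\<in>UNIV. \<Sum>k\<in>UNIV. Dten W r Nf F a b i k * W a b j k) =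
    (\<Sum>a\<in>UNIV. \<Sum>b\<in>UNIV. \<Sum>k\<in>UNIV. \<Sum>t\<in>UNIV. ?I $ i $ t * (Qprime W r Nf F a b t k * W a b j k))"
    by (simp only: sum_distrib_right mult.assoc)
  also have "\<dots> = (\<Sum>t\<in>UNIV. \<Sum>a\<in>UNIV. \<Sum>b\<in>UNIV. \<Sum>k\<in>UNIV. ?I $ i $ t * (Qprime W r Nf F a b t k * W a b j k))"
    by (subst sum.swap[of _ _ "UNIV::'n set"], subst sum.swap[of _ _ "UNIV::'n set"], subst sum.swap[of _ _ "UNIV::'n set"]) (rule refl)
  also have "\<dots> = (\<Sum>t\<in>UNIV. ?I $ i $ t * ?Q $ t $ j)"
    unfolding Q_Weyl_contraction[where Nf=Nf, OF assms(1), symmetric] sum_distrib_left ..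
  also have "\<dots> = (?I ** ?Q) $ i $ j" by (simp add: matrix_matrix_mult_def)
  also have "?I ** ?Q = mat 1" by (rule adjugate_inverse(1)[OF assms(2)])
  finally show ?thesis by (simp add: mat_def)
qed

text \<open>\<open>DC r Nf F \<Gamma> x i = D\<^sup>a\<^sup>b\<^sub>i\<^sup>c C\<^sub>c\<^sub>a\<^sub>b\<close>.\<close>
definition DC ::
  "nat \<Rightarrow> (nat \<Rightarrow> nat) \<Rightarrow> (nat \<times> nat \<Rightarrow> nat) \<Rightarrow> ('n::{finite,linorder}) christoffel \<Rightarrow>
   real^('n::{finite,linorder}) \<Rightarrow> 'n \<Rightarrow> real" where
  "DC r Nf F \<Gamma> x i =
     (\<Sum>a\<in>UNIV. \<Sum>b\<in>UNIV. \<Sum>c\<in>UNIV. Dten (weyl \<Gamma> x) r Nf F a b i c * cotton \<Gamma> x c a b)"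

definition Gten ::
  "nat \<Rightarrow> (nat \<Rightarrow> nat) \<Rightarrow> (nat \<times> nat \<Rightarrow> nat) \<Rightarrow> ('n::{finite,linorder}) christoffel \<Rightarrow> 'n cov2" where
  "Gten r Nf F \<Gamma> x i j =
     schouten \<Gamma> x i j + nabla1 \<Gamma> (DC r Nf F \<Gamma>) x i j + DC r Nf F \<Gamma> x i * DC r Nf F \<Gamma> x j"

definition Eten ::
  "nat \<Rightarrow> (nat \<Rightarrow> nat) \<Rightarrow> (nat \<times> nat \<Rightarrow> nat) \<Rightarrow> ('n::{finite,linorder}) christoffel \<Rightarrow>
   real^('n::{finite,linorder}) \<Rightarrow> 'n \<Rightarrow> 'n \<Rightarrow> 'n \<Rightarrow> real" where
  "Eten r Nf F \<Gamma> x i j k =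
     nabla2 \<Gamma> (Gten r Nf F \<Gamma>) x i j k
     + 2 * Gten r Nf F \<Gamma> x j k * DC r Nf F \<Gamma> x i
     + Gten r Nf F \<Gamma> x j i * DC r Nf F \<Gamma> x k
     + Gten r Nf F \<Gamma> x i k * DC r Nf F \<Gamma> x j"

text \<open>The section \<open>\<gamma>\<close> of \<open>(\<Lambda>\<^sup>n(T\<^sup>*M))\<^sup>2\<close>, in the coordinate trivialisation.\<close>
definition gamma_inv ::
  "nat \<Rightarrow> (nat \<Rightarrow> nat) \<Rightarrow> (nat \<times> nat \<Rightarrow> nat) \<Rightarrow> ('n::{finite,linorder}) christoffel \<Rightarrow>
   real^('n::{finite,linorder}) \<Rightarrow> real" where
  "gamma_inv r Nf F \<Gamma> x =
     (\<Sum>a | length a = CARD('n). \<Sum>b | length b = CARD('n).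
        (levi a / fact CARD('n)) * (levi b / fact CARD('n)) *
        (\<Prod>k<CARD('n). Gten r Nf F \<Gamma> x (a ! k) (b ! k)))"

end

theory Submission
  imports Defs
begin

text \<open>
  Under \<open>\<Gamma>' = \<Gamma> + \<Upsilon>\<close> the Weyl tensor is unchanged, the Schouten tensor becomes
  \<open>P\<^sub>a\<^sub>b - \<nabla>\<^sub>a\<Upsilon>\<^sub>b + \<Upsilon>\<^sub>a\<Upsilon>\<^sub>b\<close> and the Cotton tensor \<open>C\<^sub>d\<^sub>a\<^sub>b + \<Upsilon>\<^sub>c W\<^sub>a\<^sub>b\<^sup>c\<^sub>d\<close>. Contracting the last formula with
  \<open>D\<close> shows that \<open>\<Gamma>'\<close> can be Cotton-flat only for \<open>\<Upsilon> = -DC\<close>, and for this \<open>\<Upsilon>\<close> the tensors \<open>G\<close> and \<open>E\<close>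
  are the Schouten tensor of \<open>\<Gamma>'\<close> and its covariant derivative. Ricci-flat and Einstein connections have a
  parallel Schouten tensor, hence are Cotton-flat. Conversely, if \<open>E = 0\<close> then \<open>-DC\<close> is a one-form, because
  on overlaps it is the only solution of the equation for Cotton-flatness, and \<open>\<Gamma> - DC\<close> is the
  required connection, with metric \<open>G\<close> in the Einstein case.
\<close>

section \<open>Calculus of smooth functions\<close>

text \<open>All fields are given by components, so \<open>DC\<close> has to be compared between
  charts, and a direct comparison would involve the behaviour of the density-valued \<open>Q\<close>
  and of its adjugate under Jacobians. The relation \<open>D W = \<delta>\<close> offers another
  way: in each chart \<open>D\<close> is a left inverse of the map that contracts a covector with
  \<open>W\<close>, so the covector leading to Cotton-flatness is unique, whatever formula produced
  \<open>D\<close>. What has to be moved between charts is then a connection, with its Schouten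
  tensor and covariant derivatives. The price is that a Cotton-flat connection must be at hand on
  the overlap. Hence \<open>E = 0\<close> is established before the chartwise connections are
  assembled into a global one; in the Ricci-flat case it comes from \<open>G = 0\<close>, because
  \<open>E\<close> is a covariant derivative of \<open>G\<close>.\<close>

lemma pd_has_derivative:
  assumes "(f has_derivative D) (at x)"
  shows "pd i f x = D (axis i 1)"
  unfolding pd_def using frechet_derivative_at[OF assms] by simp

lemma differentiable_has_derivative:
  "f differentiable (at x) \<Longrightarrow> (f has_derivative frechet_derivative f (at x)) (at x)"
  using frechet_derivative_works by blast

lemma has_derivative_cong_open:
  assumes "open S" "x \<in> S" "\<And>y. y \<in> S \<Longrightarrow> f y = g y"
  shows "(f has_derivative D) (at x) \<longleftrightarrow> (g has_derivative D) (at x)"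
  using has_derivative_transform_within_open[OF _ assms(1,2), of f D UNIV g]
    has_derivative_transform_within_open[OF _ assms(1,2), of g D UNIV f] assms(3) by auto

lemma pd_cong:
  assumes "open S" "x \<in> S" "\<And>y. y \<in> S \<Longrightarrow> f y = g y"
  shows "pd i f x = pd i g x"
  using has_derivative_cong_open[OF assms] by (simp add: pd_def frechet_derivative_def)

lemma differentiable_cong_open:
  assumes "open S" "x \<in> S" "\<And>y. y \<in> S \<Longrightarrow> f y = g y"
  shows "f differentiable (at x) \<longleftrightarrow> g differentiable (at x)"
  using has_derivative_cong_open[OF assms] by (simp add: differentiable_def)

lemma pd_const: "pd i (\<lambda>_. c) x = 0"
  by (subst pd_has_derivative[OF has_derivative_const]) simp

lemma pd_add:
  assumes "f differentiable (at x)" "g differentiable (at x)"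
  shows "pd i (\<lambda>y. f y + g y) x = pd i f x + pd i g x"
  using pd_has_derivative[OF has_derivative_add[OF assms[THEN differentiable_has_derivative]]]
  by (simp add: pd_def)

lemma pd_diff:
  assumes "f differentiable (at x)" "g differentiable (at x)"
  shows "pd i (\<lambda>y. f y - g y) x = pd i f x - pd i g x"
  using pd_has_derivative[OF has_derivative_diff[OF assms[THEN differentiable_has_derivative]]]
  by (simp add: pd_def)

lemma pd_uminus:
  assumes "f differentiable (at x)"
  shows "pd i (\<lambda>y. - f y) x = - pd i f x"
  using pd_has_derivative[OF has_derivative_minus[OF assms[THEN differentiable_has_derivative]]]
  by (simp add: pd_def)

lemma pd_mult:
  assumes "f differentiable (at x)" "g differentiable (at x)"
  shows "pd i (\<lambda>y. f y * g y) x = pd i f x * g x + f x * pd i g x"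
  using pd_has_derivative[OF has_derivative_mult[OF assms[THEN differentiable_has_derivative]]]
  by (simp add: pd_def)

lemma pd_sum:
  assumes "\<And>l. l \<in> I \<Longrightarrow> f l differentiable (at x)"
  shows "pd i (\<lambda>y. \<Sum>l\<in>I. f l y) x = (\<Sum>l\<in>I. pd i (f l) x)"
  using pd_has_derivative[OF has_derivative_sum[of I f "\<lambda>l. frechet_derivative (f l) (at x)" "at x"]]
    assms differentiable_has_derivative by (auto simp: pd_def)

lemma pd_inverse:
  assumes "f differentiable (at x)" "f x \<noteq> 0"
  shows "pd i (\<lambda>y. inverse (f y)) x = - pd i f x * (inverse (f x) * inverse (f x))"
  using pd_has_derivative[OF Deriv.has_derivative_inverse[OF assms(2) differentiable_has_derivative[OF assms(1)]], of i]
  by (simp add: pd_def mult_ac)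

lemma has_derivative_pd:
  fixes f :: "real^'n::finite \<Rightarrow> real"
  assumes "f differentiable (at x)"
  shows "(f has_derivative (\<lambda>v. \<Sum>i\<in>UNIV. v $ i * pd i f x)) (at x)"
proof -
  have d: "(f has_derivative frechet_derivative f (at x)) (at x)"
    by (rule differentiable_has_derivative[OF assms])
  interpret linear "frechet_derivative f (at x)" by (rule linear_frechet_derivative[OF assms])
  have e: "frechet_derivative f (at x) v = (\<Sum>i\<in>UNIV. v $ i * pd i f x)" for v
  proof -
    have "v = (\<Sum>i\<in>UNIV. v $ i *\<^sub>R axis i 1)"
      using basis_expansion[of v] by (simp add: scalar_mult_eq_scaleR)
    then have "frechet_derivative f (at x) v = frechet_derivative f (at x) (\<Sum>i\<in>UNIV. v $ i *\<^sub>R axis i 1)"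
      by simp
    then show ?thesis by (simp add: sum scaleR pd_def)
  qed
  show ?thesis using d unfolding e[abs_def] .
qed

text \<open>\<open>\<tau>\<close> enters through its components because this is how smoothness of
  transition maps is stated.\<close>

lemma differentiable_compose_components:
  fixes f :: "real^'n::finite \<Rightarrow> real" and \<tau> :: "real^'m::finite \<Rightarrow> real^'n"
  assumes "f differentiable (at (\<tau> x))" "\<And>k. (\<lambda>y. \<tau> y $ k) differentiable (at x)"
  shows "(\<lambda>y. f (\<tau> y)) differentiable (at x)"
    and "pd i (\<lambda>y. f (\<tau> y)) x = (\<Sum>j\<in>UNIV. pd j f (\<tau> x) * pd i (\<lambda>y. \<tau> y $ j) x)"
proof -
  define D where "D v = (\<chi> k. frechet_derivative (\<lambda>y. \<tau> y $ k) (at x) v)" for v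
  have \<tau>: "(\<tau> has_derivative D) (at x)"
    unfolding D_def
    by (subst has_derivative_componentwise_within)
      (auto simp: Basis_vec_def inner_axis differentiable_has_derivative[OF assms(2)])
  have c: "((\<lambda>y. f (\<tau> y)) has_derivative (\<lambda>v. \<Sum>i\<in>UNIV. D v $ i * pd i f (\<tau> x))) (at x)"
    using has_derivative_compose[OF \<tau> has_derivative_pd[OF assms(1)]] by (simp add: o_def)
  show "(\<lambda>y. f (\<tau> y)) differentiable (at x)" using c by (auto simp: differentiable_def)
  show "pd i (\<lambda>y. f (\<tau> y)) x = (\<Sum>j\<in>UNIV. pd j f (\<tau> x) * pd i (\<lambda>y. \<tau> y $ j) x)"
    unfolding pd_has_derivative[OF c] by (simp add: D_def pd_def mult.commute)
qed

text \<open>\<open>Ck_on\<close> iterates \<open>pd\<close> on functions defined on all of space,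
  while the sum, product and chain rules identify \<open>pd\<close> at points of \<open>S\<close>
  only. The inductions for sums, products, inverses and compositions pass from one to the other
  through this lemma.\<close>

lemma Ck_on_cong:
  assumes "open S" "\<And>y. y \<in> S \<Longrightarrow> f y = g y" "Ck_on k S f"
  shows "Ck_on k S g"
  using assms(2,3)
proof (induction k arbitrary: f g)
  case 0 then show ?case by (simp cong: continuous_on_cong)
next
  case (Suc k)
  have "g differentiable at x" if "x \<in> S" for x
    using differentiable_cong_open[OF assms(1) that, of f g] Suc.prems that by simp
  moreover have "Ck_on k S (pd i g)" for i
    using Suc.IH[of "pd i f" "pd i g"] Suc.prems pd_cong[OF assms(1), of _ f g i] by auto
  ultimately show ?case by simp
qed

text \<open>Product and chain rule mix derivatives with undifferentiated factors, which must then be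
  available at the lower order as well.\<close>

lemma Ck_on_SucD: "Ck_on (Suc k) S f \<Longrightarrow> Ck_on k S f"
proof (induction k arbitrary: f)
  case 0
  then have "f differentiable_on S"
    by (auto simp: differentiable_on_def intro: differentiable_at_withinI)
  then show ?case by (simp add: differentiable_imp_continuous_on)
next
  case (Suc k) then show ?case using Ck_on.simps(2)[of "Suc k" S f] Ck_on.simps(2)[of k S f] by auto
qed

lemma Ck_on_const: "Ck_on k S (\<lambda>_. c)"
proof (induction k arbitrary: c)
  case (Suc k)
  have "pd i (\<lambda>_. c) = (\<lambda>_. 0)" for i :: 'a by (simp add: fun_eq_iff pd_const)
  with Suc show ?case by simp
qed (simp add: continuous_on_const)

lemma Ck_on_add:
  assumes S: "open S" shows "Ck_on k S f \<Longrightarrow> Ck_on k S g \<Longrightarrow> Ck_on k S (\<lambda>x. f x + g x)"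
proof (induction k arbitrary: f g)
  case (Suc k)
  have "Ck_on k S (pd i (\<lambda>x. f x + g x))" for i
    by (rule Ck_on_cong[OF S _ Suc.IH[of "pd i f" "pd i g"]]) (use Suc.prems in \<open>auto simp: pd_add\<close>)
  with Suc.prems show ?case by auto
qed (auto intro: continuous_on_add)

lemma Ck_on_mult:
  assumes S: "open S" shows "Ck_on k S f \<Longrightarrow> Ck_on k S g \<Longrightarrow> Ck_on k S (\<lambda>x. f x * g x)"
proof (induction k arbitrary: f g)
  case (Suc k)
  note [simp] = Ck_on_SucD[OF Suc.prems(1)] Ck_on_SucD[OF Suc.prems(2)]
  have "Ck_on k S (pd i (\<lambda>x. f x * g x))" for i
    by (rule Ck_on_cong[OF S _ Ck_on_add[OF S Suc.IH[of "pd i f" g] Suc.IH[of f "pd i g"]]])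
      (use Suc.prems in \<open>auto simp: pd_mult\<close>)
  with Suc.prems show ?case by (auto intro: differentiable_mult)
qed (auto intro: continuous_on_mult)

text \<open>The induction runs with \<open>f\<close> fixed: the derivative of the inverse consists
  of a derivative of \<open>f\<close> and of the same inverse one order lower.\<close>

lemma Ck_on_inverse:
  assumes S: "open S" "\<And>x. x \<in> S \<Longrightarrow> f x \<noteq> 0"
  shows "Ck_on k S f \<Longrightarrow> Ck_on k S (\<lambda>x. inverse (f x))"
proof (induction k)
  case 0 then show ?case using S by (auto intro: continuous_on_inverse)
next
  case (Suc k)
  have I: "Ck_on k S (\<lambda>x. inverse (f x))" by (rule Suc.IH[OF Ck_on_SucD[OF Suc.prems]])
  have "Ck_on k S (pd i (\<lambda>x. inverse (f x)))" for i
    by (rule Ck_on_cong[OF S(1) _ Ck_on_mult[OF S(1)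
          Ck_on_mult[OF S(1) Ck_on_const[where c="-1"], where g="pd i f"] Ck_on_mult[OF S(1) I I]]])
      (use Suc.prems S(2) in \<open>auto simp: pd_inverse\<close>)
  with Suc.prems S(2) show ?case by (auto intro: differentiable_inverse)
qed

lemma Ck_on_sum:
  assumes "open S" "\<And>l. l \<in> I \<Longrightarrow> Ck_on k S (f l)"
  shows "Ck_on k S (\<lambda>x. \<Sum>l\<in>I. f l x)"
  using assms(2)
  by (induction I rule: infinite_finite_induct) (auto intro: Ck_on_const Ck_on_add[OF assms(1)])

lemma Ck_on_compose:
  fixes f :: "real^'n::finite \<Rightarrow> real" and \<tau> :: "real^'m::finite \<Rightarrow> real^'n"
  assumes "open S" "\<And>x. x \<in> S \<Longrightarrow> \<tau> x \<in> T"
  shows "Ck_on k T f \<Longrightarrow> (\<And>j. Ck_on k S (\<lambda>x. \<tau> x $ j)) \<Longrightarrow> Ck_on k S (\<lambda>x. f (\<tau> x))"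
proof (induction k arbitrary: f)
  case 0
  have "continuous_on S (\<lambda>x. \<chi> j. \<tau> x $ j)" by (rule continuous_on_vec_lambda) (use 0 in simp)
  then have "continuous_on S \<tau>" by simp
  then show ?case using 0 assms(2) by (auto intro: continuous_on_compose2)
next
  case (Suc k)
  note d = differentiable_compose_components[of f \<tau>]
  have df: "f differentiable at (\<tau> x)" "\<And>j. (\<lambda>y. \<tau> y $ j) differentiable at x" if "x \<in> S" for x
    using Suc.prems assms(2) that by auto
  have "Ck_on k S (pd i (\<lambda>x. f (\<tau> x)))" for i
  proof (rule Ck_on_cong[OF assms(1)])
    show "Ck_on k S (\<lambda>x. \<Sum>j\<in>UNIV. pd j f (\<tau> x) * pd i (\<lambda>y. \<tau> y $ j) x)"
      using Suc.prems Suc.IH Ck_on_SucD[OF Suc.prems(2)]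
      by (intro Ck_on_sum Ck_on_mult assms(1)) auto
  qed (simp add: d(2) df)
  with d(1) df show ?case by simp
qed

lemma smooth_fun_cong:
  "open S \<Longrightarrow> (\<And>y. y \<in> S \<Longrightarrow> f y = g y) \<Longrightarrow> smooth_fun S f \<Longrightarrow> smooth_fun S g"
  unfolding smooth_fun_def using Ck_on_cong[of S f g] by simp

lemma smooth_fun_subset:
  assumes "smooth_fun S f" "T \<subseteq> S" shows "smooth_fun T f"
proof -
  have "Ck_on k S f \<Longrightarrow> Ck_on k T f" for k f
    using assms(2) by (induction k arbitrary: f) (auto intro: continuous_on_subset)
  with assms(1) show ?thesis by (simp add: smooth_fun_def)
qed

lemma smooth_fun_const [simp]: "smooth_fun S (\<lambda>_. c)"
  by (simp add: smooth_fun_def Ck_on_const)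

lemma smooth_fun_add: "open S \<Longrightarrow> smooth_fun S f \<Longrightarrow> smooth_fun S g \<Longrightarrow> smooth_fun S (\<lambda>x. f x + g x)"
  by (simp add: smooth_fun_def Ck_on_add)

lemma smooth_fun_mult: "open S \<Longrightarrow> smooth_fun S f \<Longrightarrow> smooth_fun S g \<Longrightarrow> smooth_fun S (\<lambda>x. f x * g x)"
  by (simp add: smooth_fun_def Ck_on_mult)

lemma smooth_fun_uminus: "open S \<Longrightarrow> smooth_fun S f \<Longrightarrow> smooth_fun S (\<lambda>x. - f x)"
  using smooth_fun_mult[of S "\<lambda>_. -1" f] by simp

lemma smooth_fun_diff: "open S \<Longrightarrow> smooth_fun S f \<Longrightarrow> smooth_fun S g \<Longrightarrow> smooth_fun S (\<lambda>x. f x - g x)"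
  using smooth_fun_add[of S f "\<lambda>x. - g x"] smooth_fun_uminus[of S g] by simp

lemma smooth_fun_sum:
  "open S \<Longrightarrow> (\<And>l. l \<in> I \<Longrightarrow> smooth_fun S (f l)) \<Longrightarrow> smooth_fun S (\<lambda>x. \<Sum>l\<in>I. f l x)"
  by (simp add: smooth_fun_def Ck_on_sum)

lemma smooth_fun_prod:
  assumes "open S" "\<And>l. l \<in> I \<Longrightarrow> smooth_fun S (f l)"
  shows "smooth_fun S (\<lambda>x. \<Prod>l\<in>I. f l x)"
  using assms(2)
  by (induction I rule: infinite_finite_induct) (auto intro: smooth_fun_mult[OF assms(1)])

lemma smooth_fun_inverse:
  "open S \<Longrightarrow> (\<And>x. x \<in> S \<Longrightarrow> f x \<noteq> 0) \<Longrightarrow> smooth_fun S f \<Longrightarrow> smooth_fun S (\<lambda>x. inverse (f x))"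
  by (simp add: smooth_fun_def Ck_on_inverse)

lemma smooth_fun_divide_const: "open S \<Longrightarrow> smooth_fun S f \<Longrightarrow> smooth_fun S (\<lambda>x. f x / c)"
  using smooth_fun_mult[of S f "\<lambda>_. inverse c"] by (simp add: divide_inverse)

lemma smooth_fun_det:
  fixes B :: "real^'n::finite \<Rightarrow> 'm::finite \<Rightarrow> 'm \<Rightarrow> real"
  assumes "open S" "\<And>i j. smooth_fun S (\<lambda>x. B x i j)"
  shows "smooth_fun S (\<lambda>x. det (\<chi> i j. B x i j))"
  unfolding det_def using assms
  by (auto intro!: smooth_fun_sum smooth_fun_mult smooth_fun_prod)

lemma smooth_fun_compose:
  "open S \<Longrightarrow> (\<And>x. x \<in> S \<Longrightarrow> \<tau> x \<in> T) \<Longrightarrow> smooth_fun T f \<Longrightarrow> (\<And>j. smooth_fun S (\<lambda>x. \<tau> x $ j))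
    \<Longrightarrow> smooth_fun S (\<lambda>x. f (\<tau> x))"
  unfolding smooth_fun_def by (rule allI, rule Ck_on_compose[of S \<tau> T]) auto

lemma smooth_fun_pd: "smooth_fun S f \<Longrightarrow> smooth_fun S (pd i f)"
  unfolding smooth_fun_def using Ck_on.simps(2)[of _ S f] by simp

lemma smooth_fun_differentiable: "smooth_fun S f \<Longrightarrow> x \<in> S \<Longrightarrow> f differentiable (at x)"
  unfolding smooth_fun_def using Ck_on.simps(2)[of 0 S f] by blast

lemma smooth_fun_continuous: "smooth_fun S f \<Longrightarrow> continuous_on S f"
  unfolding smooth_fun_def using Ck_on.simps(1)[of S f] by blast

section \<open>Symmetry of mixed second partial derivatives\<close>

lemma pd_line:
  fixes f :: "real^'n::finite \<Rightarrow> real"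
  assumes "f differentiable (at (p + t *\<^sub>R axis i 1))"
  shows "((\<lambda>t. f (p + t *\<^sub>R axis i 1)) has_real_derivative pd i f (p + t *\<^sub>R axis i 1)) (at t)"
proof -
  have "((\<lambda>t. p + t *\<^sub>R axis i 1) has_derivative (\<lambda>s. s *\<^sub>R axis i 1)) (at t)"
    by (auto intro!: derivative_eq_intros)
  from has_derivative_compose[OF this has_derivative_pd[OF assms]]
  have "((\<lambda>t. f (p + t *\<^sub>R axis i 1)) has_derivative
      (\<lambda>s. \<Sum>k\<in>UNIV. (s *\<^sub>R axis i 1) $ k * pd k f (p + t *\<^sub>R axis i 1))) (at t)" .
  moreover have "(\<Sum>k\<in>UNIV. (s *\<^sub>R axis i 1) $ k * pd k f q) = pd i f q * s" for s and q :: "real^'n"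
  proof -
    have "(s *\<^sub>R axis i 1) $ k * pd k f q = (if k = i then s * pd k f q else 0)" for k
      by (simp add: axis_def)
    then show ?thesis by (simp add: sum.delta mult.commute)
  qed
  ultimately show ?thesis by (simp add: has_field_derivative_def)
qed

text \<open>The mean value theorem is used twice: in direction \<open>i\<close> for the increment of
  \<open>f\<close> in direction \<open>j\<close>, then in direction \<open>j\<close> for
  \<open>pd i f\<close>. The left side of the equation is symmetric in \<open>i\<close> and
  \<open>j\<close>, the right side not visibly so.\<close>

lemma second_difference:
  fixes f :: "real^'n::finite \<Rightarrow> real"
  assumes "h > 0" and sub: "\<And>s t. 0 \<le> s \<Longrightarrow> s \<le> h \<Longrightarrow> 0 \<le> t \<Longrightarrow> t \<le> h \<Longrightarrow>
      x + s *\<^sub>R axis i 1 + t *\<^sub>R axis j 1 \<in> S"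
    and f: "\<And>y. y \<in> S \<Longrightarrow> f differentiable (at y)" "\<And>y. y \<in> S \<Longrightarrow> pd i f differentiable (at y)"
  obtains s t where "0 \<le> s" "s \<le> h" "0 \<le> t" "t \<le> h"
    "f (x + h *\<^sub>R axis i 1 + h *\<^sub>R axis j 1) - f (x + h *\<^sub>R axis i 1) - f (x + h *\<^sub>R axis j 1) + f x
      = h\<^sup>2 * pd j (pd i f) (x + s *\<^sub>R axis i 1 + t *\<^sub>R axis j 1)"
proof -
  define G where "G s = f ((x + h *\<^sub>R axis j 1) + s *\<^sub>R axis i 1) - f (x + s *\<^sub>R axis i 1)" for s
  have G: "(G has_real_derivative
      pd i f ((x + h *\<^sub>R axis j 1) + s *\<^sub>R axis i 1) - pd i f (x + s *\<^sub>R axis i 1)) (at s)"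
    if "0 \<le> s" "s \<le> h" for s
    unfolding G_def using sub[OF that, of h] sub[OF that, of 0] assms(1)
    by (intro DERIV_diff pd_line f) (auto simp: add_ac)
  obtain s where s: "0 < s" "s < h"
    "G h - G 0 = (h - 0) * (pd i f ((x + h *\<^sub>R axis j 1) + s *\<^sub>R axis i 1) - pd i f (x + s *\<^sub>R axis i 1))"
    using MVT2[OF assms(1), of G, OF G] by auto
  define H where "H t = pd i f ((x + s *\<^sub>R axis i 1) + t *\<^sub>R axis j 1)" for t
  have H: "(H has_real_derivative pd j (pd i f) ((x + s *\<^sub>R axis i 1) + t *\<^sub>R axis j 1)) (at t)"
    if "0 \<le> t" "t \<le> h" for t
    unfolding H_def using that s by (intro pd_line f sub) auto
  obtain t where t: "0 < t" "t < h"
    "H h - H 0 = (h - 0) * pd j (pd i f) ((x + s *\<^sub>R axis i 1) + t *\<^sub>R axis j 1)"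
    using MVT2[OF assms(1), of H, OF H] by blast
  have "G h - G 0 = h * (H h - H 0)"
    unfolding s(3) H_def by (simp add: add.assoc add.commute[of "s *\<^sub>R _"])
  also have "\<dots> = h\<^sup>2 * pd j (pd i f) (x + s *\<^sub>R axis i 1 + t *\<^sub>R axis j 1)"
    unfolding t(3) by (simp add: power2_eq_square)
  finally have "G h - G 0 = \<dots>" .
  moreover have "G h - G 0 = f (x + h *\<^sub>R axis i 1 + h *\<^sub>R axis j 1) - f (x + h *\<^sub>R axis i 1)
      - f (x + h *\<^sub>R axis j 1) + f x"
    unfolding G_def by (simp add: add.assoc add.commute[of "h *\<^sub>R axis j 1"])
  ultimately show ?thesis using that[of s t] s(1,2) t(1,2) by linarith
qed

text \<open>If the two mixed derivatives differed at \<open>x\<close>, continuity would keep them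
  apart on a small square, yet \<open>second_difference\<close> in both orders equates a value of
  one with a value of the other.\<close>

lemma pd_commute:
  fixes f :: "real^'n::finite \<Rightarrow> real"
  assumes "open S" "x \<in> S" "smooth_fun S f"
  shows "pd i (pd j f) x = pd j (pd i f) x"
proof (rule ccontr)
  assume ne: "pd i (pd j f) x \<noteq> pd j (pd i f) x"
  define e where "e = \<bar>pd i (pd j f) x - pd j (pd i f) x\<bar> / 2"
  have e: "e > 0" using ne by (simp add: e_def)
  have c: "isCont (pd k (pd l f)) x" for k l
    using smooth_fun_continuous[OF smooth_fun_pd[OF smooth_fun_pd[OF assms(3)]]] assms(1,2)
    by (simp add: continuous_on_eq_continuous_at)
  obtain d1 where d1: "d1 > 0" "\<And>y. dist y x < d1 \<Longrightarrow> dist (pd i (pd j f) y) (pd i (pd j f) x) < e"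
    using c[of i j] e unfolding continuous_at_eps_delta dist_norm by blast
  obtain d2 where d2: "d2 > 0" "\<And>y. dist y x < d2 \<Longrightarrow> dist (pd j (pd i f) y) (pd j (pd i f) x) < e"
    using c[of j i] e unfolding continuous_at_eps_delta dist_norm by blast
  obtain d3 where d3: "d3 > 0" "ball x d3 \<subseteq> S"
    using assms(1,2) open_contains_ball by blast
  \<comment> \<open>The points supplied by \<open>second_difference\<close> lie within
    \<open>2 * h\<close> of \<open>x\<close>; a third of each radius leaves them strictly inside all
    three balls.\<close>
  define h where "h = min d1 (min d2 d3) / 3"
  have h: "h > 0" "3 * h \<le> d1" "3 * h \<le> d2" "3 * h \<le> d3"
    using d1(1) d2(1) d3(1) unfolding h_def by linarith+
  have near: "dist (x + s *\<^sub>R axis k 1 + t *\<^sub>R axis l 1) x < 3 * h"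
    if "0 \<le> s" "s \<le> h" "0 \<le> t" "t \<le> h" for s t and k l :: 'n
  proof -
    have "dist (x + s *\<^sub>R axis k 1 + t *\<^sub>R axis l 1) x = norm (s *\<^sub>R axis k (1::real) + t *\<^sub>R axis l 1)"
      by (simp add: dist_norm add.assoc)
    also have "\<dots> \<le> norm (s *\<^sub>R axis k (1::real)) + norm (t *\<^sub>R axis l (1::real))" by (rule norm_triangle_ineq)
    also have "\<dots> = s + t" using that by (simp add: norm_axis_1)
    finally show ?thesis using that h by linarith
  qed
  have inS: "x + s *\<^sub>R axis k 1 + t *\<^sub>R axis l 1 \<in> S"
    if "0 \<le> s" "s \<le> h" "0 \<le> t" "t \<le> h" for s t and k l :: 'n
    using near[OF that, of k l] h d3(2) by (auto simp: dist_commute)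
  note df = smooth_fun_differentiable[OF assms(3)] smooth_fun_differentiable[OF smooth_fun_pd[OF assms(3)]]
  obtain s t where st: "0 \<le> s" "s \<le> h" "0 \<le> t" "t \<le> h"
    "f (x + h *\<^sub>R axis i 1 + h *\<^sub>R axis j 1) - f (x + h *\<^sub>R axis i 1) - f (x + h *\<^sub>R axis j 1) + f x
      = h\<^sup>2 * pd j (pd i f) (x + s *\<^sub>R axis i 1 + t *\<^sub>R axis j 1)"
    by (rule second_difference[OF h(1), where x=x and i=i and j=j and f=f and S=S]) (use inS df in auto)
  obtain s' t' where st': "0 \<le> s'" "s' \<le> h" "0 \<le> t'" "t' \<le> h"
    "f (x + h *\<^sub>R axis j 1 + h *\<^sub>R axis i 1) - f (x + h *\<^sub>R axis j 1) - f (x + h *\<^sub>R axis i 1) + f x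
      = h\<^sup>2 * pd i (pd j f) (x + s' *\<^sub>R axis j 1 + t' *\<^sub>R axis i 1)"
    by (rule second_difference[OF h(1), where x=x and i=j and j=i and f=f and S=S]) (use inS df in auto)
  have "h\<^sup>2 * pd j (pd i f) (x + s *\<^sub>R axis i 1 + t *\<^sub>R axis j 1)
      = h\<^sup>2 * pd i (pd j f) (x + s' *\<^sub>R axis j 1 + t' *\<^sub>R axis i 1)"
    unfolding st(5)[symmetric] st'(5)[symmetric] by (simp add: add_ac)
  then have eq: "pd j (pd i f) (x + s *\<^sub>R axis i 1 + t *\<^sub>R axis j 1)
      = pd i (pd j f) (x + s' *\<^sub>R axis j 1 + t' *\<^sub>R axis i 1)" using h(1) by simp
  have "dist (pd i (pd j f) (x + s' *\<^sub>R axis j 1 + t' *\<^sub>R axis i 1)) (pd i (pd j f) x) < e"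
    using near[OF st'(1-4), of j i] h by (intro d1(2)) linarith
  moreover have "dist (pd j (pd i f) (x + s *\<^sub>R axis i 1 + t *\<^sub>R axis j 1)) (pd j (pd i f) x) < e"
    using near[OF st(1-4), of i j] h by (intro d2(2)) linarith
  ultimately have "dist (pd i (pd j f) x) (pd j (pd i f) x) < e + e"
    using dist_triangle3[of "pd i (pd j f) x" "pd j (pd i f) x"
        "pd i (pd j f) (x + s' *\<^sub>R axis j 1 + t' *\<^sub>R axis i 1)"]
    unfolding eq by linarith
  then show False by (simp add: e_def dist_real_def)
qed

section \<open>Projective change of a connection\<close>

lemmas smooth_fun_intros = smooth_fun_const smooth_fun_add smooth_fun_diff smooth_fun_uminus
  smooth_fun_mult smooth_fun_sum smooth_fun_divide_const smooth_fun_pd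

text \<open>The local conditions of \<open>torsion_free_connection\<close>, for an arbitrary open
  set because the calculus is applied on chart images and on overlaps alike.\<close>

definition smooth_connection_on :: "(real^'n::finite) set \<Rightarrow> 'n christoffel \<Rightarrow> bool" where
  "smooth_connection_on S \<Gamma> \<longleftrightarrow> open S \<and> (\<forall>k a b. smooth_fun S (\<lambda>x. \<Gamma> x k a b)) \<and>
     (\<forall>x\<in>S. \<forall>k a b. \<Gamma> x k a b = \<Gamma> x k b a)"

lemma smooth_connection_onD:
  assumes "smooth_connection_on S \<Gamma>"
  shows "open S" "smooth_fun S (\<lambda>x. \<Gamma> x k a b)" "x \<in> S \<Longrightarrow> \<Gamma> x k a b = \<Gamma> x k b a"
  using assms by (simp_all add: smooth_connection_on_def)

lemma smooth_connection_on_subset: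
  "smooth_connection_on S \<Gamma> \<Longrightarrow> open T \<Longrightarrow> T \<subseteq> S \<Longrightarrow> smooth_connection_on T \<Gamma>"
  unfolding smooth_connection_on_def using smooth_fun_subset by (metis subsetD)

lemma smooth_nabla1:
  assumes "smooth_connection_on S \<Gamma>" "\<And>a. smooth_fun S (\<lambda>x. u x a)"
  shows "smooth_fun S (\<lambda>x. nabla1 \<Gamma> u x a b)"
  unfolding nabla1_def by (intro smooth_fun_intros smooth_connection_onD[OF assms(1)] assms(2))

lemma smooth_nabla2:
  assumes "smooth_connection_on S \<Gamma>" "\<And>a b. smooth_fun S (\<lambda>x. h x a b)"
  shows "smooth_fun S (\<lambda>x. nabla2 \<Gamma> h x i j k)"
  unfolding nabla2_def by (intro smooth_fun_intros smooth_connection_onD[OF assms(1)] assms(2))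

context
  fixes S :: "(real^'n::finite) set" and \<Gamma> :: "'n christoffel"
  assumes \<Gamma>: "smooth_connection_on S \<Gamma>"
begin

lemma smooth_curv: "smooth_fun S (\<lambda>x. curv \<Gamma> x a b c d)"
  unfolding curv_def by (intro smooth_fun_intros smooth_connection_onD[OF \<Gamma>])

lemma smooth_ric: "smooth_fun S (\<lambda>x. ric \<Gamma> x a b)"
  unfolding ric_def by (intro smooth_fun_intros smooth_curv smooth_connection_onD[OF \<Gamma>])

lemma smooth_beta: "smooth_fun S (\<lambda>x. beta \<Gamma> x a b)"
  unfolding beta_def by (intro smooth_fun_intros smooth_ric smooth_connection_onD[OF \<Gamma>])

lemma smooth_schouten: "smooth_fun S (\<lambda>x. schouten \<Gamma> x a b)"
  unfolding schouten_def by (intro smooth_fun_intros smooth_ric smooth_beta smooth_connection_onD[OF \<Gamma>])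

lemma smooth_weyl: "smooth_fun S (\<lambda>x. weyl \<Gamma> x a b c d)"
  unfolding weyl_def
  by (intro smooth_fun_intros smooth_curv smooth_schouten smooth_beta smooth_connection_onD[OF \<Gamma>])

lemma smooth_cotton: "smooth_fun S (\<lambda>x. cotton \<Gamma> x d a b)"
  unfolding cotton_def
  by (intro smooth_fun_intros smooth_nabla2[OF \<Gamma>] smooth_schouten smooth_connection_onD[OF \<Gamma>])

text \<open>For \<open>u = \<Upsilon>\<close> this trades the skewed second derivatives in
  \<open>cotton_change\<close> for curvature. The sign is opposite to that for vectors because the
  connection acts on covectors by minus the transpose.\<close>

lemma ricci_identity_covector:
  assumes u: "\<And>a. smooth_fun S (\<lambda>x. u x a)" and x: "x \<in> S"
  shows "nabla2 \<Gamma> (nabla1 \<Gamma> u) x a b d - nabla2 \<Gamma> (nabla1 \<Gamma> u) x b a d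
    = - (\<Sum>c\<in>UNIV. curv \<Gamma> x a b c d * u x c)"
proof -
  note S = smooth_connection_onD[OF \<Gamma>]
  note df = smooth_fun_differentiable[OF _ x]
  have 1: "pd a (\<lambda>y. nabla1 \<Gamma> u y b d) x = pd a (pd b (\<lambda>y. u y d)) x
      - ((\<Sum>l\<in>UNIV. pd a (\<lambda>y. \<Gamma> y l b d) x * u x l) + (\<Sum>l\<in>UNIV. \<Gamma> x l b d * pd a (\<lambda>y. u y l) x))" for a b
    unfolding nabla1_def sum.distrib[symmetric]
    by (simp add: pd_diff pd_sum pd_mult df S u smooth_fun_pd)
  have 2: "(\<Sum>l\<in>UNIV. \<Gamma> x l a d * nabla1 \<Gamma> u x b l) = (\<Sum>l\<in>UNIV. \<Gamma> x l a d * pd b (\<lambda>y. u y l) x)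
      - (\<Sum>c\<in>UNIV. (\<Sum>e\<in>UNIV. \<Gamma> x c b e * \<Gamma> x e a d) * u x c)" for a b
    unfolding nabla1_def right_diff_distrib sum_subtractf sum_distrib_left sum_distrib_right
    by (subst (2) sum.swap) (simp add: mult_ac)
  \<comment> \<open>Torsion-freeness: the terms in which the outer derivative acts on the index of
    the inner one cancel in the commutator.\<close>
  have 3: "(\<Sum>l\<in>UNIV. \<Gamma> x l b a * nabla1 \<Gamma> u x l d) = (\<Sum>l\<in>UNIV. \<Gamma> x l a b * nabla1 \<Gamma> u x l d)"
    by (simp only: S(3)[OF x, of _ b a])
  have 4: "(\<Sum>c\<in>UNIV. curv \<Gamma> x a b c d * u x c) =
      (\<Sum>l\<in>UNIV. pd a (\<lambda>y. \<Gamma> y l b d) x * u x l) - (\<Sum>l\<in>UNIV. pd b (\<lambda>y. \<Gamma> y l a d) x * u x l)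
      + (\<Sum>c\<in>UNIV. (\<Sum>e\<in>UNIV. \<Gamma> x c a e * \<Gamma> x e b d) * u x c)
      - (\<Sum>c\<in>UNIV. (\<Sum>e\<in>UNIV. \<Gamma> x c b e * \<Gamma> x e a d) * u x c)"
    unfolding curv_def by (simp only: left_diff_distrib distrib_right sum.distrib sum_subtractf)
  have 5: "pd a (pd b (\<lambda>y. u y d)) x = pd b (pd a (\<lambda>y. u y d)) x"
    by (rule pd_commute[OF S(1) x u])
  show ?thesis unfolding nabla2_def 1 2 3 4 5 by simp
qed

end

text \<open>The shape of the quadratic term in \<open>curv \<Gamma>'\<close>: \<open>A\<close> and
  \<open>C\<close> are Christoffel symbols, \<open>p\<close>, \<open>r\<close>, \<open>s\<close> and
  \<open>B\<close> are components of \<open>\<Upsilon>\<close>, and \<open>q\<close> is a Kronecker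
  delta.\<close>

lemma sum_kron_product:
  fixes A B C :: "'n::finite \<Rightarrow> real"
  shows "(\<Sum>e\<in>UNIV. (A e + p * kron c e + B e * q) * (C e + r * kron e d + s * kron e b)) =
    (\<Sum>e\<in>UNIV. A e * C e) + r * A d + s * A b + p * C c + p * r * kron c d + p * s * kron c b
    + q * (\<Sum>e\<in>UNIV. B e * C e) + q * r * B d + q * s * B b"
proof -
  have "(\<Sum>e\<in>UNIV. (A e + p * kron c e + B e * q) * (C e + r * kron e d + s * kron e b)) =
    (\<Sum>e\<in>UNIV. A e * C e + r * (A e * kron e d) + s * (A e * kron e b) + p * (kron c e * C e)
      + (p * r) * (kron c e * kron e d) + (p * s) * (kron c e * kron e b)
      + q * (B e * C e) + (q * r) * (B e * kron e d) + (q * s) * (B e * kron e b))"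
    by (intro sum.cong refl) (simp only: ring_distribs mult_ac add_ac)
  also have "\<dots> = (\<Sum>e\<in>UNIV. A e * C e) + r * A d + s * A b + p * C c + p * r * kron c d + p * s * kron c b
    + q * (\<Sum>e\<in>UNIV. B e * C e) + q * r * B d + q * s * B b"
    unfolding sum.distrib sum_distrib_left[symmetric] kron_sums by (rule refl)
  finally show ?thesis .
qed

lemma weyl_decomposition:
  fixes \<Gamma> :: "('n::finite) christoffel"
  assumes "smooth_connection_on S \<Gamma>" "CARD('n) \<ge> 2" "x \<in> S"
  shows "(\<forall>a b c d. curv \<Gamma> x a b c d = weyl \<Gamma> x a b c d
        + (kron c a * schouten \<Gamma> x b d - kron c b * schouten \<Gamma> x a d) + beta \<Gamma> x a b * kron c d) \<and>
      (\<forall>a b. beta \<Gamma> x a b = schouten \<Gamma> x b a - schouten \<Gamma> x a b) \<and>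
      (\<forall>a b. (\<Sum>c\<in>UNIV. weyl \<Gamma> x c a c b) = 0 \<and> (\<Sum>c\<in>UNIV. weyl \<Gamma> x a c c b) = 0 \<and>
         (\<Sum>c\<in>UNIV. weyl \<Gamma> x a b c c) = 0)"
  by (subst curvature_decomposition[OF assms(2) smooth_connection_onD(1)[OF assms(1)] assms(3), of \<Gamma>])
    (auto simp: smooth_connection_onD(3)[OF assms(1)])

locale projective_change =
  fixes S :: "(real^'n::finite) set" and \<Gamma> \<Gamma>' :: "'n christoffel" and \<Upsilon> :: "real^'n \<Rightarrow> 'n \<Rightarrow> real"
  assumes \<Gamma>: "smooth_connection_on S \<Gamma>"
    and smooth_\<Upsilon>: "smooth_fun S (\<lambda>x. \<Upsilon> x a)"
    and \<Gamma>'_eq: "x \<in> S \<Longrightarrow> \<Gamma>' x k a b = \<Gamma> x k a b + \<Upsilon> x a * kron k b + \<Upsilon> x b * kron k a"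
    and dim: "CARD('n) \<ge> 2"
begin

lemmas S = smooth_connection_onD[OF \<Gamma>]

lemma \<Gamma>': "smooth_connection_on S \<Gamma>'"
  unfolding smooth_connection_on_def
proof (intro conjI allI ballI)
  show "smooth_fun S (\<lambda>x. \<Gamma>' x k a b)" for k a b
    by (rule smooth_fun_cong[OF S(1) \<Gamma>'_eq[symmetric]], assumption)
      (intro smooth_fun_intros S smooth_\<Upsilon>)
qed (simp_all add: S \<Gamma>'_eq)

text \<open>Sorted by Kronecker deltas, the change has the form of the curvature decomposition: a
  \<open>beta\<close> term at \<open>kron c d\<close>, Schouten terms at \<open>kron c a\<close> and
  \<open>kron c b\<close>, and nothing in the Weyl part.\<close>

lemma curv_change:
  assumes x: "x \<in> S"
  shows "curv \<Gamma>' x a b c d = curv \<Gamma> x a b c d + (nabla1 \<Gamma> \<Upsilon> x a b - nabla1 \<Gamma> \<Upsilon> x b a) * kron c d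
    + kron c b * (nabla1 \<Gamma> \<Upsilon> x a d - \<Upsilon> x a * \<Upsilon> x d) - kron c a * (nabla1 \<Gamma> \<Upsilon> x b d - \<Upsilon> x b * \<Upsilon> x d)"
proof -
  note df = smooth_fun_differentiable[OF _ x]
  have 1: "pd a (\<lambda>y. \<Gamma>' y c b d) x = pd a (\<lambda>y. \<Gamma> y c b d) x + pd a (\<lambda>y. \<Upsilon> y b) x * kron c d
      + pd a (\<lambda>y. \<Upsilon> y d) x * kron c b" for a b c d
  proof -
    have "pd a (\<lambda>y. \<Gamma>' y c b d) x = pd a (\<lambda>y. \<Gamma> y c b d + \<Upsilon> y b * kron c d + \<Upsilon> y d * kron c b) x"
      by (rule pd_cong[OF S(1) x \<Gamma>'_eq])
    also have "\<dots> = pd a (\<lambda>y. \<Gamma> y c b d) x + pd a (\<lambda>y. \<Upsilon> y b) x * kron c d + pd a (\<lambda>y. \<Upsilon> y d) x * kron c b"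
      by (simp add: pd_add pd_mult pd_const df S smooth_\<Upsilon>)
    finally show ?thesis .
  qed
  have 2: "(\<Sum>e\<in>UNIV. \<Gamma>' x c a e * \<Gamma>' x e b d) = (\<Sum>e\<in>UNIV. \<Gamma> x c a e * \<Gamma> x e b d)
      + \<Upsilon> x b * \<Gamma> x c a d + \<Upsilon> x d * \<Gamma> x c a b + \<Upsilon> x a * \<Gamma> x c b d
      + \<Upsilon> x a * \<Upsilon> x b * kron c d + \<Upsilon> x a * \<Upsilon> x d * kron c b
      + kron c a * (\<Sum>e\<in>UNIV. \<Upsilon> x e * \<Gamma> x e b d) + kron c a * \<Upsilon> x b * \<Upsilon> x d + kron c a * \<Upsilon> x d * \<Upsilon> x b" for a b
    unfolding \<Gamma>'_eq[OF x] by (rule sum_kron_product)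
  have 3: "(\<Sum>e\<in>UNIV. \<Upsilon> x e * \<Gamma> x e a d) = (\<Sum>l\<in>UNIV. \<Gamma> x l a d * \<Upsilon> x l)" for a
    by (simp only: mult.commute)
  have 4: "\<Gamma> x l b a = \<Gamma> x l a b" for l by (rule S(3)[OF x])
  show ?thesis
    unfolding curv_def nabla1_def 1 2 3 4 by (simp add: algebra_simps)
qed

text \<open>Both follow from uniqueness in \<open>curvature_decomposition\<close>: once the new
  terms of \<open>curv_change\<close> are absorbed into the Schouten and \<open>beta\<close> parts,
  the old Weyl tensor remains, and it is trace-free already.\<close>

lemma
  assumes x: "x \<in> S"
  shows weyl_change: "weyl \<Gamma>' x = weyl \<Gamma> x"
    and schouten_change: "schouten \<Gamma>' x a b = schouten \<Gamma> x a b - nabla1 \<Gamma> \<Upsilon> x a b + \<Upsilon> x a * \<Upsilon> x b"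
proof -
  note dec = curvature_decomposition[OF dim S(1) x]
  note G = weyl_decomposition[OF \<Gamma> dim x]
  have "weyl \<Gamma> x = weyl \<Gamma>' x \<and>
    (\<lambda>a b. schouten \<Gamma> x a b - nabla1 \<Gamma> \<Upsilon> x a b + \<Upsilon> x a * \<Upsilon> x b) = schouten \<Gamma>' x \<and>
    (\<lambda>a b. beta \<Gamma> x a b + nabla1 \<Gamma> \<Upsilon> x a b - nabla1 \<Gamma> \<Upsilon> x b a) = beta \<Gamma>' x"
    by (subst dec[of \<Gamma>', symmetric])
      (use G smooth_connection_onD(3)[OF \<Gamma>'] in \<open>auto simp: curv_change[OF x] algebra_simps\<close>)
  then show "weyl \<Gamma>' x = weyl \<Gamma> x"
    "schouten \<Gamma>' x a b = schouten \<Gamma> x a b - nabla1 \<Gamma> \<Upsilon> x a b + \<Upsilon> x a * \<Upsilon> x b"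
    by (auto simp: fun_eq_iff)
qed

text \<open>The weights 2, 1, 1 in \<open>Eten\<close> originate here: \<open>\<Upsilon> x i\<close>
  appears once for each slot of \<open>h\<close>, and each slot trades its index with
  \<open>i\<close> once. As \<open>h\<close> need not be symmetric, the order in
  \<open>h x j i\<close> matters.\<close>

lemma nabla2_change:
  assumes x: "x \<in> S"
  shows "nabla2 \<Gamma>' h x i j k = nabla2 \<Gamma> h x i j k - 2 * \<Upsilon> x i * h x j k - \<Upsilon> x j * h x i k - \<Upsilon> x k * h x j i"
proof -
  have 1: "(\<Sum>l\<in>UNIV. \<Gamma>' x l i j * f l) = (\<Sum>l\<in>UNIV. \<Gamma> x l i j * f l) + \<Upsilon> x i * f j + \<Upsilon> x j * f i" for i j f
  proof -
    have "(\<Sum>l\<in>UNIV. \<Gamma>' x l i j * f l) =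
      (\<Sum>l\<in>UNIV. \<Gamma> x l i j * f l + \<Upsilon> x i * (kron l j * f l) + \<Upsilon> x j * (kron l i * f l))"
      unfolding \<Gamma>'_eq[OF x] by (intro sum.cong refl) (simp only: ring_distribs mult_ac)
    then show ?thesis unfolding sum.distrib sum_distrib_left[symmetric] kron_sums .
  qed
  show ?thesis unfolding nabla2_def 1 by (simp add: algebra_simps)
qed

text \<open>The commutator of derivatives of \<open>\<Upsilon>\<close> yields the full curvature.
  Its Schouten and \<open>beta\<close> parts cancel against the products of
  \<open>\<Upsilon>\<close> with the Schouten tensor from \<open>nabla2_change\<close>, the terms in
  \<open>nabla1 \<Gamma> \<Upsilon>\<close> cancel among themselves, and the Weyl part
  survives.\<close>

lemma cotton_change:
  assumes x: "x \<in> S"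
  shows "cotton \<Gamma>' x d a b = cotton \<Gamma> x d a b + (\<Sum>c\<in>UNIV. weyl \<Gamma> x a b c d * \<Upsilon> x c)"
proof -
  note df = smooth_fun_differentiable[OF _ x]
  have 1: "nabla2 \<Gamma> (schouten \<Gamma>') x a b d = nabla2 \<Gamma> (schouten \<Gamma>) x a b d
     - nabla2 \<Gamma> (nabla1 \<Gamma> \<Upsilon>) x a b d + nabla1 \<Gamma> \<Upsilon> x a b * \<Upsilon> x d + \<Upsilon> x b * nabla1 \<Gamma> \<Upsilon> x a d" for a b d
  proof -
    have p: "pd a (\<lambda>y. schouten \<Gamma>' y b d) x = pd a (\<lambda>y. schouten \<Gamma> y b d) x - pd a (\<lambda>y. nabla1 \<Gamma> \<Upsilon> y b d) x
      + (pd a (\<lambda>y. \<Upsilon> y b) x * \<Upsilon> x d + \<Upsilon> x b * pd a (\<lambda>y. \<Upsilon> y d) x)"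
    proof -
      have "pd a (\<lambda>y. schouten \<Gamma>' y b d) x
          = pd a (\<lambda>y. schouten \<Gamma> y b d - nabla1 \<Gamma> \<Upsilon> y b d + \<Upsilon> y b * \<Upsilon> y d) x"
        by (rule pd_cong[OF S(1) x schouten_change])
      then show ?thesis
        by (simp add: pd_add pd_diff pd_mult df smooth_\<Upsilon> smooth_schouten[OF \<Gamma>] smooth_nabla1[OF \<Gamma>])
    qed
    have "(\<Sum>l\<in>UNIV. \<Gamma> x l a b * schouten \<Gamma>' x l d) = (\<Sum>l\<in>UNIV. \<Gamma> x l a b * schouten \<Gamma> x l d)
        - (\<Sum>l\<in>UNIV. \<Gamma> x l a b * nabla1 \<Gamma> \<Upsilon> x l d) + (\<Sum>l\<in>UNIV. \<Gamma> x l a b * \<Upsilon> x l) * \<Upsilon> x d"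
      "(\<Sum>l\<in>UNIV. \<Gamma> x l a d * schouten \<Gamma>' x b l) = (\<Sum>l\<in>UNIV. \<Gamma> x l a d * schouten \<Gamma> x b l)
        - (\<Sum>l\<in>UNIV. \<Gamma> x l a d * nabla1 \<Gamma> \<Upsilon> x b l) + \<Upsilon> x b * (\<Sum>l\<in>UNIV. \<Gamma> x l a d * \<Upsilon> x l)"
      unfolding schouten_change[OF x] sum_distrib_left sum_distrib_right ring_distribs sum.distrib sum_subtractf
      by (simp_all add: mult_ac)
    then show ?thesis
      unfolding nabla2_def p unfolding nabla1_def[of \<Gamma> \<Upsilon> x a] by (simp add: algebra_simps)
  qed
  have 2: "(\<Sum>c\<in>UNIV. curv \<Gamma> x a b c d * \<Upsilon> x c) = (\<Sum>c\<in>UNIV. weyl \<Gamma> x a b c d * \<Upsilon> x c)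
      + \<Upsilon> x a * schouten \<Gamma> x b d - \<Upsilon> x b * schouten \<Gamma> x a d + beta \<Gamma> x a b * \<Upsilon> x d"
  proof -
    have "(\<Sum>c\<in>UNIV. curv \<Gamma> x a b c d * \<Upsilon> x c) = (\<Sum>c\<in>UNIV. weyl \<Gamma> x a b c d * \<Upsilon> x c
      + schouten \<Gamma> x b d * (kron c a * \<Upsilon> x c) - schouten \<Gamma> x a d * (kron c b * \<Upsilon> x c)
      + beta \<Gamma> x a b * (kron c d * \<Upsilon> x c))"
      by (intro sum.cong refl) (simp only: weyl_def, simp only: algebra_simps)
    then show ?thesis
      unfolding sum.distrib sum_subtractf sum_distrib_left[symmetric] kron_sums by (simp only: mult.commute)
  qed
  have 3: "beta \<Gamma> x a b = schouten \<Gamma> x b a - schouten \<Gamma> x a b"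
    using weyl_decomposition[OF \<Gamma> dim x] by blast
  show ?thesis
    using ricci_identity_covector[where u=\<Upsilon> and a=a and b=b and d=d, OF \<Gamma> smooth_\<Upsilon> x]
    unfolding cotton_def nabla2_change[OF x] 1 2 3 schouten_change[OF x]
    by (simp add: algebra_simps)
qed

end

section \<open>The one-form \<open>DC\<close>\<close>

lemma smooth_wpow:
  assumes "open S" "\<And>a b c d. smooth_fun S (\<lambda>x. W x a b c d)"
  shows "smooth_fun S (\<lambda>x. wpow (W x) k a s t)"
  by (induction k arbitrary: s) (auto intro!: smooth_fun_intros assms)

lemma smooth_Qten:
  assumes "open S" "\<And>a b c d. smooth_fun S (\<lambda>x. W x a b c d)"
  shows "smooth_fun S (\<lambda>x. Qten (W x) r Nf F bs t s)"
  unfolding Qten_def by (intro smooth_fun_intros smooth_fun_prod smooth_wpow assms)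

lemma smooth_Dten:
  assumes "open S" "\<And>a b c d. smooth_fun S (\<lambda>x. W x a b c d)"
    and "\<And>x. x \<in> S \<Longrightarrow> det (Qmat (W x) r Nf F) \<noteq> 0"
  shows "smooth_fun S (\<lambda>x. Dten (W x) r Nf F a b i k)"
proof -
  have "smooth_fun S (\<lambda>x. det (Qmat (W x) r Nf F))"
    unfolding Qmat_def by (intro smooth_fun_det smooth_Qten assms)
  moreover have "smooth_fun S (\<lambda>x. adjugate (Qmat (W x) r Nf F) $ i $ t)" for t
  proof -
    have "smooth_fun S (\<lambda>x. if l = i then kron k t else Qten (W x) r Nf F [] k l)" for k l
      by (cases "l = i") (simp_all add: smooth_Qten assms)
    then show ?thesis
      unfolding adjugate_def Qmat_def vec_lambda_beta by (rule smooth_fun_det[OF assms(1)])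
  qed
  ultimately show ?thesis
    unfolding Dten_def Qprime_def
    by (intro smooth_fun_intros smooth_fun_inverse smooth_Qten assms)
qed

lemma smooth_DC:
  assumes "smooth_connection_on S \<Gamma>" "\<And>x. x \<in> S \<Longrightarrow> det (Qmat (weyl \<Gamma> x) r Nf F) \<noteq> 0"
  shows "smooth_fun S (\<lambda>x. DC r Nf F \<Gamma> x i)"
  unfolding DC_def
  by (intro smooth_fun_intros smooth_Dten smooth_weyl[OF assms(1)] smooth_cotton[OF assms(1)]
      smooth_connection_onD(1)[OF assms(1)] assms(2))

section \<open>Ricci and Einstein conditions in terms of the Schouten tensor\<close>

lemma schouten_einstein:
  fixes \<Gamma> :: "('n::finite) christoffel"
  assumes "\<And>a b. ric \<Gamma> x a b = K * g a b" "\<And>a b. g a b = g b a"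
  shows "schouten \<Gamma> x a b = K / (real CARD('n) - 1) * g a b"
  unfolding schouten_def beta_def assms(1) assms(2)[of b a] by simp

lemma ric_eq_schouten:
  fixes \<Gamma> :: "('n::finite) christoffel"
  assumes "smooth_connection_on S \<Gamma>" "CARD('n) \<ge> 2" "x \<in> S" "schouten \<Gamma> x a b = schouten \<Gamma> x b a"
  shows "ric \<Gamma> x a b = (real CARD('n) - 1) * schouten \<Gamma> x a b"
proof -
  have "beta \<Gamma> x a b = 0" using weyl_decomposition[OF assms(1-3)] assms(4) by simp
  then show ?thesis using assms(2) unfolding schouten_def by simp
qed

lemma nabla2_cong:
  assumes "open S" "x \<in> S" "\<And>y i j. y \<in> S \<Longrightarrow> h y i j = h' y i j"
  shows "nabla2 \<Gamma> h x i j k = nabla2 \<Gamma> h' x i j k"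
proof -
  have "pd i (\<lambda>y. h y j k) x = pd i (\<lambda>y. h' y j k) x"
    by (rule pd_cong[OF assms(1,2)]) (rule assms(3))
  then show ?thesis unfolding nabla2_def by (simp add: assms(3)[OF assms(2)])
qed

lemma nabla2_cmult:
  assumes "\<And>i j. (\<lambda>x. h x i j) differentiable (at x)"
  shows "nabla2 \<Gamma> (\<lambda>x i j. q * h x i j) x i j k = q * nabla2 \<Gamma> h x i j k"
  unfolding nabla2_def
  by (simp add: pd_mult pd_const assms right_diff_distrib sum_distrib_left mult_ac)

lemma cotton_0_of_schouten_parallel:
  assumes "\<And>i j k. nabla2 \<Gamma> (schouten \<Gamma>) x i j k = 0"
  shows "cotton \<Gamma> x d a b = 0"
  by (simp add: cotton_def assms)

lemma schouten_0_parallel: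
  assumes "open S" "x \<in> S" "\<And>y i j. y \<in> S \<Longrightarrow> schouten \<Gamma> y i j = 0"
  shows "nabla2 \<Gamma> (schouten \<Gamma>) x i j k = 0"
  using nabla2_cong[OF assms(1,2), of "schouten \<Gamma>" "\<lambda>_ _ _. 0" \<Gamma>] assms(3)
  by (simp add: nabla2_def pd_const)

text \<open>The condition on \<open>Q\<close> is imposed for \<open>\<Gamma>\<close>; by
  \<open>weyl_change\<close> it is the same condition for \<open>\<Gamma>'\<close>.\<close>

locale nondegenerate_projective_change = projective_change S \<Gamma> \<Gamma>' \<Upsilon>
  for S :: "(real^'n::{finite,linorder}) set" and \<Gamma> \<Gamma>' :: "'n christoffel" and \<Upsilon> +
  fixes r :: nat and Nf :: "nat \<Rightarrow> nat" and F :: "nat \<times> nat \<Rightarrow> nat"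
  assumes Nf0: "Nf 0 \<ge> 1"
    and Q: "x \<in> S \<Longrightarrow> det (Qmat (weyl \<Gamma> x) r Nf F) \<noteq> 0"
begin

text \<open>\<open>D\<close> depends on the connection through its Weyl tensor alone and is
  therefore common to both connections; contracting \<open>cotton_change\<close> with it leaves
  \<open>\<Upsilon>\<close> by \<open>D_Weyl_contraction\<close>.\<close>

lemma DC_change:
  assumes x: "x \<in> S"
  shows "DC r Nf F \<Gamma>' x i = DC r Nf F \<Gamma> x i + \<Upsilon> x i"
proof -
  let ?D = "Dten (weyl \<Gamma> x) r Nf F"
  have "DC r Nf F \<Gamma>' x i = DC r Nf F \<Gamma> x i +
     (\<Sum>a\<in>UNIV. \<Sum>b\<in>UNIV. \<Sum>d\<in>UNIV. \<Sum>c\<in>UNIV. \<Upsilon> x c * (?D a b i d * weyl \<Gamma> x a b c d))"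
    unfolding DC_def weyl_change[OF x] cotton_change[OF x] distrib_left sum.distrib sum_distrib_left
    by (simp add: mult_ac)
  also have "(\<Sum>a\<in>UNIV. \<Sum>b\<in>UNIV. \<Sum>d\<in>UNIV. \<Sum>c\<in>UNIV. \<Upsilon> x c * (?D a b i d * weyl \<Gamma> x a b c d))
     = (\<Sum>c\<in>UNIV. \<Sum>a\<in>UNIV. \<Sum>b\<in>UNIV. \<Sum>d\<in>UNIV. \<Upsilon> x c * (?D a b i d * weyl \<Gamma> x a b c d))"
    by (subst sum.swap[of _ _ "UNIV::'n set"], subst sum.swap[of _ _ "UNIV::'n set"],
        subst sum.swap[of _ _ "UNIV::'n set"]) (rule refl)
  also have "\<dots> = (\<Sum>c\<in>UNIV. \<Upsilon> x c * kron i c)"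
    unfolding D_Weyl_contraction[where Nf=Nf, OF Nf0 Q[OF x], symmetric] sum_distrib_left ..
  finally show ?thesis unfolding kron_sums .
qed

lemma \<Upsilon>_eq_DC:
  assumes x: "x \<in> S" and "\<And>d a b. cotton \<Gamma>' x d a b = 0"
  shows "\<Upsilon> x i = - DC r Nf F \<Gamma> x i"
  using DC_change[OF x, of i] by (simp add: DC_def[of r Nf F \<Gamma>'] assms(2))

text \<open>Substituting \<open>\<Upsilon> = -DC\<close> into \<open>schouten_change\<close> and
  \<open>nabla2_change\<close> gives the defining formulas of \<open>Gten\<close> and
  \<open>Eten\<close> term by term. The substitution must hold on all of \<open>S\<close>, since
  both formulas differentiate.\<close>

lemma
  assumes \<Upsilon>: "\<And>x i. x \<in> S \<Longrightarrow> \<Upsilon> x i = - DC r Nf F \<Gamma> x i" and x: "x \<in> S"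
  shows Gten_eq_schouten: "Gten r Nf F \<Gamma> x i j = schouten \<Gamma>' x i j"
    and Eten_eq_nabla_schouten: "Eten r Nf F \<Gamma> x i j k = nabla2 \<Gamma>' (schouten \<Gamma>') x i j k"
proof -
  have DC: "DC r Nf F \<Gamma> y i = - \<Upsilon> y i" if "y \<in> S" for y i using \<Upsilon>[OF that] by simp
  have *: "Gten r Nf F \<Gamma> x i j = schouten \<Gamma>' x i j" if x: "x \<in> S" for x i j
  proof -
    have "pd i (\<lambda>y. DC r Nf F \<Gamma> y j) x = pd i (\<lambda>y. - \<Upsilon> y j) x"
      by (rule pd_cong[OF S(1) x DC])
    also have "\<dots> = - pd i (\<lambda>y. \<Upsilon> y j) x"
      by (rule pd_uminus[OF smooth_fun_differentiable[OF smooth_\<Upsilon> x]])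
    finally have "nabla1 \<Gamma> (DC r Nf F \<Gamma>) x i j = - nabla1 \<Gamma> \<Upsilon> x i j"
      unfolding nabla1_def by (simp add: DC[OF x] sum_negf)
    then show ?thesis unfolding Gten_def schouten_change[OF x] by (simp add: DC[OF x])
  qed
  show "Gten r Nf F \<Gamma> x i j = schouten \<Gamma>' x i j" by (rule *[OF x])
  show "Eten r Nf F \<Gamma> x i j k = nabla2 \<Gamma>' (schouten \<Gamma>') x i j k"
    using nabla2_cong[OF S(1) x, of "Gten r Nf F \<Gamma>" "schouten \<Gamma>'" \<Gamma> i j k] *
    unfolding Eten_def nabla2_change[OF x] *[OF x] DC[OF x] by (simp add: algebra_simps)
qed

end

section \<open>Change of coordinates\<close>

lemma sum_rotate3: "(\<Sum>i\<in>A. \<Sum>j\<in>B. \<Sum>k\<in>C. f i j k) = (\<Sum>j\<in>B. \<Sum>k\<in>C. \<Sum>i\<in>A. f i j k)"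
  by (subst sum.swap, rule sum.cong[OF refl], rule sum.swap)

lemma sum_reverse3: "(\<Sum>i\<in>A. \<Sum>j\<in>B. \<Sum>k\<in>C. f i j k) = (\<Sum>k\<in>C. \<Sum>j\<in>B. \<Sum>i\<in>A. f i j k)"
  by (subst sum_rotate3, subst sum.swap) (rule refl)

lemma sum_exchange4:
  "(\<Sum>i\<in>A. \<Sum>j\<in>B. \<Sum>k\<in>C. \<Sum>l\<in>D. f i j k l) = (\<Sum>l\<in>D. \<Sum>j\<in>B. \<Sum>k\<in>C. \<Sum>i\<in>A. f i j k l)"
proof -
  have "(\<Sum>i\<in>A. \<Sum>j\<in>B. \<Sum>k\<in>C. \<Sum>l\<in>D. f i j k l) = (\<Sum>j\<in>B. \<Sum>i\<in>A. \<Sum>k\<in>C. \<Sum>l\<in>D. f i j k l)"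
    by (rule sum.swap)
  also have "\<dots> = (\<Sum>j\<in>B. \<Sum>l\<in>D. \<Sum>k\<in>C. \<Sum>i\<in>A. f i j k l)"
    by (rule sum.cong[OF refl], rule sum_reverse3)
  also have "\<dots> = (\<Sum>l\<in>D. \<Sum>j\<in>B. \<Sum>k\<in>C. \<Sum>i\<in>A. f i j k l)" by (rule sum.swap)
  finally show ?thesis .
qed

text \<open>\<open>K\<close> is the inverse Jacobian, supplied as data because in use it is the
  Jacobian of the reverse transition. It enters in \<open>ric_pullback\<close>, where the
  contravariant index of the curvature is traced.\<close>

locale coordinate_change =
  fixes U V :: "(real^'n::finite) set" and \<tau> :: "real^'n \<Rightarrow> real^'n"
    and J :: "real^'n \<Rightarrow> 'n \<Rightarrow> 'n \<Rightarrow> real" and K :: "real^'n \<Rightarrow> 'n \<Rightarrow> 'n \<Rightarrow> real"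
    and \<Gamma> \<Gamma>' :: "'n christoffel"
  assumes \<Gamma>: "smooth_connection_on U \<Gamma>" and \<Gamma>': "smooth_connection_on V \<Gamma>'"
    and \<tau>: "x \<in> U \<Longrightarrow> \<tau> x \<in> V"
    and smooth_\<tau>: "smooth_fun U (\<lambda>x. \<tau> x $ k)"
    and J_def: "\<And>x k a. J x k a = pd a (\<lambda>z. \<tau> z $ k) x"
    and J_inverse: "x \<in> U \<Longrightarrow> (\<Sum>c\<in>UNIV. J x i c * K x c k) = kron i k"
      "x \<in> U \<Longrightarrow> (\<Sum>k\<in>UNIV. K x c k * J x k d) = kron c d"
    and law: "x \<in> U \<Longrightarrow> (\<Sum>l\<in>UNIV. J x k l * \<Gamma> x l a b) = pd a (\<lambda>z. J z k b) x +
        (\<Sum>i\<in>UNIV. \<Sum>j\<in>UNIV. \<Gamma>' (\<tau> x) k i j * J x i a * J x j b)"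
begin

lemmas U = smooth_connection_onD[OF \<Gamma>]

lemma smooth_J: "smooth_fun U (\<lambda>x. J x k a)"
  unfolding J_def by (intro smooth_fun_pd smooth_\<tau>)

lemma pd_J_commute: "x \<in> U \<Longrightarrow> pd a (\<lambda>z. J z k b) x = pd b (\<lambda>z. J z k a) x"
  unfolding J_def by (rule pd_commute[OF U(1) _ smooth_\<tau>])

lemma
  assumes x: "x \<in> U" and f: "smooth_fun V f"
  shows differentiable_pullback: "(\<lambda>z. f (\<tau> z)) differentiable (at x)"
    and pd_pullback: "pd a (\<lambda>z. f (\<tau> z)) x = (\<Sum>m\<in>UNIV. pd m f (\<tau> x) * J x m a)"
  unfolding J_def
  using differentiable_compose_components[OF smooth_fun_differentiable[OF f \<tau>[OF x]]
      smooth_fun_differentiable[OF smooth_\<tau> x]] by blast+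

text \<open>The connection form of the pulled-back bundle; \<open>J\<close> acts as a gauge transformation from
  \<open>\<Gamma>\<close> to it.\<close>
definition A :: "real^'n \<Rightarrow> 'n \<Rightarrow> 'n \<Rightarrow> 'n \<Rightarrow> real" where
  "A x a k j = (\<Sum>i\<in>UNIV. \<Gamma>' (\<tau> x) k i j * J x i a)"

text \<open>In matrices: \<open>J \<Gamma>_a = d_a J + A_a J\<close>. In this form the curvatures
  can be compared without inverting \<open>J\<close>.\<close>

lemma gauge:
  assumes "x \<in> U"
  shows "(\<Sum>l\<in>UNIV. J x k l * \<Gamma> x l a b) = pd a (\<lambda>z. J z k b) x + (\<Sum>j\<in>UNIV. A x a k j * J x j b)"
  unfolding law[OF assms] A_def sum_distrib_right by (subst sum.swap) (rule refl)

lemma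
  assumes x: "x \<in> U"
  shows differentiable_A: "(\<lambda>z. A z a k j) differentiable (at x)"
    and pd_A: "pd b (\<lambda>z. A z a k j) x = (\<Sum>i\<in>UNIV. \<Sum>m\<in>UNIV. pd m (\<lambda>y. \<Gamma>' y k i j) (\<tau> x) * J x m b * J x i a)
      + (\<Sum>i\<in>UNIV. \<Gamma>' (\<tau> x) k i j * pd b (\<lambda>z. J z i a) x)"
proof -
  note d = differentiable_pullback[OF x smooth_connection_onD(2)[OF \<Gamma>']]
    smooth_fun_differentiable[OF smooth_J x]
  show "(\<lambda>z. A z a k j) differentiable (at x)" unfolding A_def by (simp add: d)
  show "pd b (\<lambda>z. A z a k j) x = (\<Sum>i\<in>UNIV. \<Sum>m\<in>UNIV. pd m (\<lambda>y. \<Gamma>' y k i j) (\<tau> x) * J x m b * J x i a)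
      + (\<Sum>i\<in>UNIV. \<Gamma>' (\<tau> x) k i j * pd b (\<lambda>z. J z i a) x)"
    unfolding A_def
    by (simp add: pd_sum pd_mult d pd_pullback[OF x smooth_connection_onD(2)[OF \<Gamma>']] sum.distrib sum_distrib_right)
qed

text \<open>Second derivatives of the coordinate change are symmetric in \<open>a\<close> and
  \<open>b\<close> by \<open>pd_J_commute\<close> and drop out of the skewed expression, so the
  curvature of the pulled-back connection form is the pullback of the curvature.\<close>

lemma curvature_A:
  assumes x: "x \<in> U"
  shows "pd a (\<lambda>z. A z b k j) x - pd b (\<lambda>z. A z a k j) x
      + (\<Sum>e\<in>UNIV. A x a k e * A x b e j) - (\<Sum>e\<in>UNIV. A x b k e * A x a e j)
    = (\<Sum>m\<in>UNIV. \<Sum>i\<in>UNIV. curv \<Gamma>' (\<tau> x) m i k j * J x m a * J x i b)"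
proof -
  have 1: "(\<Sum>i\<in>UNIV. \<Sum>m\<in>UNIV. pd m (\<lambda>y. \<Gamma>' y k i j) (\<tau> x) * J x m a * J x i b)
     = (\<Sum>m\<in>UNIV. \<Sum>i\<in>UNIV. pd m (\<lambda>y. \<Gamma>' y k i j) (\<tau> x) * J x m a * J x i b)"
    by (rule sum.swap)
  have 2: "(\<Sum>e\<in>UNIV. A x a k e * A x b e j)
    = (\<Sum>m\<in>UNIV. \<Sum>i\<in>UNIV. (\<Sum>e\<in>UNIV. \<Gamma>' (\<tau> x) k m e * \<Gamma>' (\<tau> x) e i j) * J x m a * J x i b)" for a b
  proof -
    have "(\<Sum>e\<in>UNIV. A x a k e * A x b e j) = (\<Sum>e\<in>UNIV. \<Sum>m\<in>UNIV. \<Sum>i\<in>UNIV.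
        \<Gamma>' (\<tau> x) k m e * \<Gamma>' (\<tau> x) e i j * J x m a * J x i b)"
      unfolding A_def sum_product by (simp add: mult_ac)
    also have "\<dots> = (\<Sum>m\<in>UNIV. \<Sum>i\<in>UNIV. \<Sum>e\<in>UNIV.
        \<Gamma>' (\<tau> x) k m e * \<Gamma>' (\<tau> x) e i j * J x m a * J x i b)"
      by (rule sum_rotate3)
    finally show ?thesis by (simp add: sum_distrib_right)
  qed
  have 3: "(\<Sum>m\<in>UNIV. \<Sum>i\<in>UNIV. f m i * J x m b * J x i a) = (\<Sum>m\<in>UNIV. \<Sum>i\<in>UNIV. f i m * J x m a * J x i b)" for f
    by (subst sum.swap) (simp add: mult_ac)
  have 4: "(\<Sum>i\<in>UNIV. \<Sum>m\<in>UNIV. pd m (\<lambda>y. \<Gamma>' y k i j) (\<tau> x) * J x m b * J x i a)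
     = (\<Sum>m\<in>UNIV. \<Sum>i\<in>UNIV. pd i (\<lambda>y. \<Gamma>' y k m j) (\<tau> x) * J x m a * J x i b)"
    by (intro sum.cong refl) simp
  show ?thesis
    unfolding pd_A[OF x] pd_J_commute[OF x, of b _ a] 1 2 3[of "\<lambda>m i. \<Sum>e\<in>UNIV. \<Gamma>' (\<tau> x) k m e * \<Gamma>' (\<tau> x) e i j"] 4
    by (simp add: curv_def left_diff_distrib distrib_right sum.distrib sum_subtractf)
qed

text \<open>Differentiating \<open>gauge\<close> and skewing in the two directions shows that
  \<open>J\<close> times the curvature of \<open>\<Gamma>\<close> is the curvature of
  \<open>A\<close> times \<open>J\<close>; \<open>curvature_A\<close> then evaluates the
  latter.\<close>

lemma curv_pullback:
  assumes x: "x \<in> U"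
  shows "(\<Sum>l\<in>UNIV. J x k l * curv \<Gamma> x a b l d) =
    (\<Sum>j\<in>UNIV. (\<Sum>m\<in>UNIV. \<Sum>i\<in>UNIV. curv \<Gamma>' (\<tau> x) m i k j * J x m a * J x i b) * J x j d)"
proof -
  note d = smooth_fun_differentiable[OF smooth_J x] smooth_fun_differentiable[OF U(2) x]
    smooth_fun_differentiable[OF smooth_fun_pd[OF smooth_J] x] differentiable_A[OF x]
  have 1: "(\<Sum>l\<in>UNIV. pd a (\<lambda>z. J z k l) x * \<Gamma> x l b d) + (\<Sum>l\<in>UNIV. J x k l * pd a (\<lambda>z. \<Gamma> z l b d) x)
     = pd a (pd b (\<lambda>z. J z k d)) x + (\<Sum>j\<in>UNIV. pd a (\<lambda>z. A z b k j) x * J x j d)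
       + (\<Sum>j\<in>UNIV. A x b k j * pd a (\<lambda>z. J z j d) x)" for a b
  proof -
    have "pd a (\<lambda>x. \<Sum>l\<in>UNIV. J x k l * \<Gamma> x l b d) x =
      pd a (\<lambda>x. pd b (\<lambda>z. J z k d) x + (\<Sum>j\<in>UNIV. A x b k j * J x j d)) x"
      by (rule pd_cong[OF U(1) x gauge])
    then show ?thesis by (simp add: pd_add pd_mult pd_sum d sum.distrib)
  qed
  \<comment> \<open>Two uses of \<open>gauge\<close>. After skewing in \<open>a\<close> and
    \<open>b\<close>, the cross terms produced here cancel the terms with first derivatives of
    \<open>J\<close> in 1.\<close>
  have 2: "(\<Sum>l\<in>UNIV. J x k l * (\<Sum>e\<in>UNIV. \<Gamma> x l a e * \<Gamma> x e b d)) =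
      (\<Sum>e\<in>UNIV. pd a (\<lambda>z. J z k e) x * \<Gamma> x e b d) + (\<Sum>j\<in>UNIV. A x a k j * pd b (\<lambda>z. J z j d) x)
      + (\<Sum>j\<in>UNIV. (\<Sum>e\<in>UNIV. A x a k e * A x b e j) * J x j d)" for a b
  proof -
    have "(\<Sum>l\<in>UNIV. J x k l * (\<Sum>e\<in>UNIV. \<Gamma> x l a e * \<Gamma> x e b d))
       = (\<Sum>e\<in>UNIV. (\<Sum>l\<in>UNIV. J x k l * \<Gamma> x l a e) * \<Gamma> x e b d)"
      unfolding sum_distrib_left sum_distrib_right by (subst sum.swap) (simp add: mult_ac)
    also have "\<dots> = (\<Sum>e\<in>UNIV. pd a (\<lambda>z. J z k e) x * \<Gamma> x e b d)
       + (\<Sum>e\<in>UNIV. \<Sum>j\<in>UNIV. A x a k j * J x j e * \<Gamma> x e b d)"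
      unfolding gauge[OF x] by (simp add: distrib_right sum.distrib sum_distrib_right)
    also have "(\<Sum>e\<in>UNIV. \<Sum>j\<in>UNIV. A x a k j * J x j e * \<Gamma> x e b d)
       = (\<Sum>j\<in>UNIV. A x a k j * (\<Sum>e\<in>UNIV. J x j e * \<Gamma> x e b d))"
      unfolding sum_distrib_left by (subst sum.swap) (simp add: mult_ac)
    also have "\<dots> = (\<Sum>j\<in>UNIV. A x a k j * pd b (\<lambda>z. J z j d) x)
       + (\<Sum>j\<in>UNIV. \<Sum>m\<in>UNIV. A x a k j * A x b j m * J x m d)"
      unfolding gauge[OF x] by (simp add: distrib_left sum.distrib sum_distrib_left mult_ac)
    also have "(\<Sum>j\<in>UNIV. \<Sum>m\<in>UNIV. A x a k j * A x b j m * J x m d)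
       = (\<Sum>j\<in>UNIV. (\<Sum>e\<in>UNIV. A x a k e * A x b e j) * J x j d)"
      unfolding sum_distrib_right by (rule sum.swap)
    finally show ?thesis by simp
  qed
  have 3: "pd a (pd b (\<lambda>z. J z k d)) x = pd b (pd a (\<lambda>z. J z k d)) x"
    by (rule pd_commute[OF U(1) x smooth_J])
  have "(\<Sum>l\<in>UNIV. J x k l * curv \<Gamma> x a b l d) =
     (\<Sum>l\<in>UNIV. J x k l * pd a (\<lambda>z. \<Gamma> z l b d) x) - (\<Sum>l\<in>UNIV. J x k l * pd b (\<lambda>z. \<Gamma> z l a d) x)
     + (\<Sum>l\<in>UNIV. J x k l * (\<Sum>e\<in>UNIV. \<Gamma> x l a e * \<Gamma> x e b d))
     - (\<Sum>l\<in>UNIV. J x k l * (\<Sum>e\<in>UNIV. \<Gamma> x l b e * \<Gamma> x e a d))"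
    unfolding curv_def by (simp add: right_diff_distrib distrib_left sum.distrib sum_subtractf)
  also have "\<dots> = (\<Sum>j\<in>UNIV. pd a (\<lambda>z. A z b k j) x * J x j d) - (\<Sum>j\<in>UNIV. pd b (\<lambda>z. A z a k j) x * J x j d)
     + (\<Sum>j\<in>UNIV. (\<Sum>e\<in>UNIV. A x a k e * A x b e j) * J x j d)
     - (\<Sum>j\<in>UNIV. (\<Sum>e\<in>UNIV. A x b k e * A x a e j) * J x j d)"
    using 1[of a b] 1[of b a] 3 unfolding 2 by linarith
  also have "\<dots> = (\<Sum>j\<in>UNIV. (\<Sum>m\<in>UNIV. \<Sum>i\<in>UNIV. curv \<Gamma>' (\<tau> x) m i k j * J x m a * J x i b) * J x j d)"
    unfolding curvature_A[OF x, symmetric]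
    by (simp only: left_diff_distrib distrib_right sum.distrib sum_subtractf)
  finally show ?thesis .
qed

lemma ric_pullback:
  assumes x: "x \<in> U"
  shows "ric \<Gamma> x b d = (\<Sum>i\<in>UNIV. \<Sum>j\<in>UNIV. J x i b * J x j d * ric \<Gamma>' (\<tau> x) i j)"
proof -
  \<comment> \<open>The curvature at \<open>\<tau> x\<close> with the lower indices \<open>i\<close>
    and \<open>j\<close> already pulled back; \<open>m\<close> and \<open>k\<close> are the pair to
    be traced, where \<open>J\<close> and \<open>K\<close> meet and cancel.\<close>
  define X where "X m k = (\<Sum>i\<in>UNIV. \<Sum>j\<in>UNIV. curv \<Gamma>' (\<tau> x) m i k j * J x i b * J x j d)" for m k
  have 1: "curv \<Gamma> x a b c d = (\<Sum>k\<in>UNIV. \<Sum>m\<in>UNIV. (J x m a * K x c k) * X m k)" for a c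
  proof -
    have JR: "(\<Sum>l\<in>UNIV. J x k l * curv \<Gamma> x a b l d) = (\<Sum>m\<in>UNIV. J x m a * X m k)" for k
    proof -
      have "(\<Sum>l\<in>UNIV. J x k l * curv \<Gamma> x a b l d) = (\<Sum>j\<in>UNIV. \<Sum>m\<in>UNIV. \<Sum>i\<in>UNIV.
          J x m a * (curv \<Gamma>' (\<tau> x) m i k j * J x i b * J x j d))"
        unfolding curv_pullback[OF x] sum_distrib_right by (simp add: mult_ac)
      also have "\<dots> = (\<Sum>m\<in>UNIV. \<Sum>i\<in>UNIV. \<Sum>j\<in>UNIV.
          J x m a * (curv \<Gamma>' (\<tau> x) m i k j * J x i b * J x j d))"
        by (rule sum_rotate3)
      finally show ?thesis unfolding X_def sum_distrib_left .
    qed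
    have "curv \<Gamma> x a b c d = (\<Sum>l\<in>UNIV. (\<Sum>k\<in>UNIV. K x c k * J x k l) * curv \<Gamma> x a b l d)"
      unfolding J_inverse(2)[OF x] kron_sums ..
    also have "\<dots> = (\<Sum>k\<in>UNIV. K x c k * (\<Sum>l\<in>UNIV. J x k l * curv \<Gamma> x a b l d))"
      unfolding sum_distrib_left sum_distrib_right by (subst sum.swap) (simp add: mult_ac)
    finally show ?thesis unfolding JR sum_distrib_left by (simp add: mult_ac)
  qed
  have "ric \<Gamma> x b d = (\<Sum>k\<in>UNIV. \<Sum>m\<in>UNIV. \<Sum>c\<in>UNIV. (J x m c * K x c k) * X m k)"
    unfolding ric_def 1 by (rule sum_rotate3)
  also have "\<dots> = (\<Sum>k\<in>UNIV. X k k)"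
    unfolding sum_distrib_right[symmetric] J_inverse(1)[OF x] kron_sums ..
  also have "\<dots> = (\<Sum>i\<in>UNIV. \<Sum>j\<in>UNIV. \<Sum>k\<in>UNIV. curv \<Gamma>' (\<tau> x) k i k j * J x i b * J x j d)"
    unfolding X_def by (rule sum_rotate3)
  finally show ?thesis unfolding ric_def sum_distrib_left by (simp add: mult_ac)
qed

lemma schouten_pullback:
  assumes x: "x \<in> U"
  shows "schouten \<Gamma> x b d = (\<Sum>i\<in>UNIV. \<Sum>j\<in>UNIV. J x i b * J x j d * schouten \<Gamma>' (\<tau> x) i j)"
proof -
  define n where "n = real CARD('n)"
  have sw: "ric \<Gamma> x d b = (\<Sum>i\<in>UNIV. \<Sum>j\<in>UNIV. J x i b * J x j d * ric \<Gamma>' (\<tau> x) j i)"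
    unfolding ric_pullback[OF x] by (subst sum.swap) (simp add: mult_ac)
  have beta: "beta \<Gamma> x b d = (\<Sum>i\<in>UNIV. \<Sum>j\<in>UNIV. J x i b * J x j d * beta \<Gamma>' (\<tau> x) i j)"
    unfolding beta_def sw ric_pullback[OF x, of b d]
    by (simp add: sum_subtractf right_diff_distrib sum_divide_distrib diff_divide_distrib)
  show ?thesis
    unfolding schouten_def beta ric_pullback[OF x, of b d]
    by (simp add: sum.distrib distrib_left sum_divide_distrib add_divide_distrib)
qed

text \<open>The derivatives of \<open>J\<close> that arise from differentiating the pullback cancel
  against the inhomogeneous part of \<open>law\<close>, once for each slot of
  \<open>h\<close>.\<close>

lemma nabla2_pullback:
  assumes h: "\<And>y b d. y \<in> U \<Longrightarrow> h y b d = (\<Sum>i\<in>UNIV. \<Sum>j\<in>UNIV. J y i b * J y j d * h' (\<tau> y) i j)"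
    and h': "\<And>i j. smooth_fun V (\<lambda>y. h' y i j)" and x: "x \<in> U"
  shows "nabla2 \<Gamma> h x a b d = (\<Sum>i\<in>UNIV. \<Sum>j\<in>UNIV. \<Sum>m\<in>UNIV. J x i b * J x j d * J x m a * nabla2 \<Gamma>' h' (\<tau> x) m i j)"
proof -
  note d = smooth_fun_differentiable[OF smooth_J x] differentiable_pullback[OF x h']
  let ?h = "h' (\<tau> x)"
  have 1: "pd a (\<lambda>y. h y b d) x = (\<Sum>i\<in>UNIV. \<Sum>j\<in>UNIV. pd a (\<lambda>z. J z i b) x * J x j d * ?h i j)
     + (\<Sum>i\<in>UNIV. \<Sum>j\<in>UNIV. J x i b * pd a (\<lambda>z. J z j d) x * ?h i j)
     + (\<Sum>i\<in>UNIV. \<Sum>j\<in>UNIV. \<Sum>m\<in>UNIV. J x i b * J x j d * J x m a * pd m (\<lambda>y. h' y i j) (\<tau> x))"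
  proof -
    have "pd a (\<lambda>y. h y b d) x = pd a (\<lambda>y. \<Sum>i\<in>UNIV. \<Sum>j\<in>UNIV. J y i b * J y j d * h' (\<tau> y) i j) x"
      by (rule pd_cong[OF U(1) x h])
    then show ?thesis
      by (simp add: pd_mult pd_sum d pd_pullback[OF x h'] sum.distrib distrib_right distrib_left sum_distrib_left mult_ac)
  qed
  have 2: "(\<Sum>l\<in>UNIV. \<Gamma> x l a b * h x l d) = (\<Sum>i\<in>UNIV. \<Sum>j\<in>UNIV. pd a (\<lambda>z. J z i b) x * J x j d * ?h i j)
     + (\<Sum>i\<in>UNIV. \<Sum>j\<in>UNIV. \<Sum>m\<in>UNIV. J x i b * J x j d * J x m a * (\<Sum>l\<in>UNIV. \<Gamma>' (\<tau> x) l m i * ?h l j))"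
  proof -
    have "(\<Sum>l\<in>UNIV. \<Gamma> x l a b * h x l d) = (\<Sum>l\<in>UNIV. \<Sum>i\<in>UNIV. \<Sum>j\<in>UNIV. J x i l * \<Gamma> x l a b * (J x j d * ?h i j))"
      unfolding h[OF x] sum_distrib_left by (simp add: mult_ac)
    also have "\<dots> = (\<Sum>i\<in>UNIV. \<Sum>j\<in>UNIV. (\<Sum>l\<in>UNIV. J x i l * \<Gamma> x l a b) * (J x j d * ?h i j))"
      unfolding sum_distrib_right by (rule sum_rotate3)
    also have "\<dots> = (\<Sum>i\<in>UNIV. \<Sum>j\<in>UNIV. pd a (\<lambda>z. J z i b) x * J x j d * ?h i j)
      + (\<Sum>l\<in>UNIV. \<Sum>j\<in>UNIV. \<Sum>m\<in>UNIV. \<Sum>i\<in>UNIV. \<Gamma>' (\<tau> x) l m i * J x m a * J x i b * (J x j d * ?h l j))"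
      unfolding law[OF x] by (simp add: distrib_right distrib_left sum.distrib sum_distrib_left sum_distrib_right mult_ac)
    also have "(\<Sum>l\<in>UNIV. \<Sum>j\<in>UNIV. \<Sum>m\<in>UNIV. \<Sum>i\<in>UNIV. \<Gamma>' (\<tau> x) l m i * J x m a * J x i b * (J x j d * ?h l j))
      = (\<Sum>i\<in>UNIV. \<Sum>j\<in>UNIV. \<Sum>m\<in>UNIV. \<Sum>l\<in>UNIV. \<Gamma>' (\<tau> x) l m i * J x m a * J x i b * (J x j d * ?h l j))"
      by (rule sum_exchange4)
    finally show ?thesis unfolding sum_distrib_left by (simp add: mult_ac)
  qed
  have 3: "(\<Sum>l\<in>UNIV. \<Gamma> x l a d * h x b l) = (\<Sum>i\<in>UNIV. \<Sum>j\<in>UNIV. J x i b * pd a (\<lambda>z. J z j d) x * ?h i j)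
     + (\<Sum>i\<in>UNIV. \<Sum>j\<in>UNIV. \<Sum>m\<in>UNIV. J x i b * J x j d * J x m a * (\<Sum>l\<in>UNIV. \<Gamma>' (\<tau> x) l m j * ?h i l))"
  proof -
    have "(\<Sum>l\<in>UNIV. \<Gamma> x l a d * h x b l) = (\<Sum>l\<in>UNIV. \<Sum>i\<in>UNIV. \<Sum>j\<in>UNIV. J x j l * \<Gamma> x l a d * (J x i b * ?h i j))"
      unfolding h[OF x] sum_distrib_left by (simp add: mult_ac)
    also have "\<dots> = (\<Sum>i\<in>UNIV. \<Sum>j\<in>UNIV. (\<Sum>l\<in>UNIV. J x j l * \<Gamma> x l a d) * (J x i b * ?h i j))"
      unfolding sum_distrib_right by (rule sum_rotate3)
    also have "\<dots> = (\<Sum>i\<in>UNIV. \<Sum>j\<in>UNIV. J x i b * pd a (\<lambda>z. J z j d) x * ?h i j)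
      + (\<Sum>i\<in>UNIV. \<Sum>l\<in>UNIV. \<Sum>m\<in>UNIV. \<Sum>j\<in>UNIV. \<Gamma>' (\<tau> x) l m j * J x m a * J x j d * (J x i b * ?h i l))"
      unfolding law[OF x] by (simp add: distrib_right distrib_left sum.distrib sum_distrib_left sum_distrib_right mult_ac)
    also have "(\<Sum>i\<in>UNIV. \<Sum>l\<in>UNIV. \<Sum>m\<in>UNIV. \<Sum>j\<in>UNIV. \<Gamma>' (\<tau> x) l m j * J x m a * J x j d * (J x i b * ?h i l))
      = (\<Sum>i\<in>UNIV. \<Sum>j\<in>UNIV. \<Sum>m\<in>UNIV. \<Sum>l\<in>UNIV. \<Gamma>' (\<tau> x) l m j * J x m a * J x j d * (J x i b * ?h i l))"
      by (rule sum.cong[OF refl], rule sum_reverse3)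
    finally show ?thesis unfolding sum_distrib_left by (simp add: mult_ac)
  qed
  show ?thesis
    unfolding nabla2_def[of \<Gamma>] nabla2_def[of \<Gamma>'] 1 2 3
    by (simp add: right_diff_distrib sum_subtractf)
qed

lemma schouten_parallel_pullback:
  assumes "\<And>y i j k. y \<in> V \<Longrightarrow> nabla2 \<Gamma>' (schouten \<Gamma>') y i j k = 0" "x \<in> U"
  shows "nabla2 \<Gamma> (schouten \<Gamma>) x i j k = 0"
  using nabla2_pullback[OF schouten_pullback smooth_schouten[OF \<Gamma>'] assms(2)]
  by (simp add: assms(1)[OF \<tau>[OF assms(2)]])

end

section \<open>Nondegeneracy of \<open>G\<close>\<close>

text \<open>\<open>levi\<close> takes row \<open>i\<close> from the list entry at position
  \<open>card {k. k < i}\<close>; this bijection turns sums over lists of length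
  \<open>CARD('n)\<close> into sums over all maps from \<open>'n\<close> to
  \<open>'n\<close>.\<close>

lemma bij_betw_rank:
  "bij_betw (\<lambda>i::'n::{finite,linorder}. card {k. k < i}) UNIV {..<CARD('n)}"
proof -
  have lt: "card {k. k < i} < card {k. k < j}" if "i < j" for i j :: 'n
    using that by (intro psubset_card_mono) auto
  have inj: "inj (\<lambda>i::'n. card {k. k < i})"
    by (rule injI) (metis lt less_irrefl linorder_less_linear)
  moreover have "(\<lambda>i::'n. card {k. k < i}) ` UNIV = {..<CARD('n)}"
  proof (rule card_subset_eq)
    have "card {k. k < i} < CARD('n)" for i :: 'n by (intro psubset_card_mono) auto
    then show "(\<lambda>i::'n. card {k. k < i}) ` UNIV \<subseteq> {..<CARD('n)}" by auto
  qed (simp_all add: card_image[OF inj])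
  ultimately show ?thesis by (simp add: bij_betw_def)
qed

text \<open>Multilinearity: each row of \<open>B\<close> is expanded in the standard basis.
  \<open>h\<close> runs over all maps, the non-injective ones contributing 0 through the
  determinant.\<close>

lemma sum_det_kron_prod:
  fixes B :: "'n::finite \<Rightarrow> 'n \<Rightarrow> real"
  shows "(\<Sum>h\<in>UNIV. det (\<chi> i j. kron (h i) (j::'n)) * (\<Prod>i\<in>UNIV. B i (h i))) = det (\<chi> i j. B i j)"
proof -
  have 1: "(\<chi> i. \<Sum>j\<in>UNIV. B i j *s (\<chi> l. kron j l)) = (\<chi> i j. B i j)"
    by (simp add: vec_eq_iff kron_sums)
  have 2: "det (\<chi> i. B i (h i) *s (\<chi> l. kron (h i) l)) = det (\<chi> i j. kron (h i) (j::'n)) * (\<Prod>i\<in>UNIV. B i (h i))" for h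
    by (subst det_rows_mul) (simp add: mult.commute)
  have "det (\<chi> i. \<Sum>j\<in>UNIV. B i j *s (\<chi> l. kron j l)) = (\<Sum>h\<in>UNIV. det (\<chi> i. B i (h i) *s (\<chi> l. kron (h i) l)))"
    by (subst det_linear_rows_sum) simp_all
  then show ?thesis unfolding 1 2 ..
qed

text \<open>For fixed \<open>f\<close> the sum over \<open>h\<close> is the determinant of the
  matrix whose row \<open>i\<close> is row \<open>f i\<close> of \<open>G\<close>, that is
  \<open>L f\<close> times \<open>det G\<close>. Thus \<open>gamma_inv\<close> is
  \<open>det G\<close> times a sum of squares over the square of \<open>n!\<close>, and the identity
  map makes this sum positive.\<close>

lemma gamma_inv_nonzero_iff:
  fixes \<Gamma> :: "('n::{finite,linorder}) christoffel"
  shows "gamma_inv r Nf F \<Gamma> x \<noteq> 0 \<longleftrightarrow> det (\<chi> i j. Gten r Nf F \<Gamma> x i j) \<noteq> 0"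
proof -
  define G where "G = Gten r Nf F \<Gamma> x"
  define n where "n = CARD('n)"
  define rk where "rk (i::'n) = card {k. k < i}" for i
  define e where "e = inv_into (UNIV::'n set) rk"
  define L where "L (f::'n \<Rightarrow> 'n) = det (\<chi> i j. kron (f i) (j::'n))" for f
  have rk: "bij_betw rk UNIV {..<n}" unfolding rk_def n_def by (rule bij_betw_rank)
  have e1: "e (rk i) = i" for i unfolding e_def by (rule inv_into_f_f[OF bij_betw_imp_inj_on[OF rk]]) simp
  have e2: "rk (e k) = k" if "k < n" for k
    unfolding e_def using that rk by (intro f_inv_into_f) (auto simp: bij_betw_def)
  have rn: "rk i < n" for i using rk by (auto simp: bij_betw_def)
  have lists: "(\<Sum>a | length a = n. X (\<lambda>i. a ! rk i)) = (\<Sum>f\<in>UNIV. X f)" for X :: "('n \<Rightarrow> 'n) \<Rightarrow> real"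
    by (rule sum.reindex_bij_witness[of _ "\<lambda>f. map (\<lambda>k. f (e k)) [0..<n]" "\<lambda>a i. a ! rk i"])
      (auto simp: e1 e2 rn intro!: nth_equalityI)
  have "gamma_inv r Nf F \<Gamma> x = (\<Sum>a | length a = n. \<Sum>b | length b = n.
      (L (\<lambda>i. a ! rk i) / fact n) * (L (\<lambda>i. b ! rk i) / fact n) * (\<Prod>i\<in>UNIV. G (a ! rk i) (b ! rk i)))"
    unfolding gamma_inv_def levi_def L_def rk_def[symmetric] n_def[symmetric] G_def[symmetric]
    by (simp add: prod.reindex_bij_betw[OF rk, of "\<lambda>k. G (a ! k) (b ! k)" for a b])
  also have "\<dots> = (\<Sum>f\<in>UNIV. \<Sum>h\<in>UNIV. (L f / fact n) * (L h / fact n) * (\<Prod>i\<in>UNIV. G (f i) (h i)))"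
    by (subst lists[symmetric], subst lists[symmetric]) (rule refl)
  also have "\<dots> = (\<Sum>f\<in>UNIV. L f / (fact n * fact n) * (\<Sum>h\<in>UNIV. L h * (\<Prod>i\<in>UNIV. G (f i) (h i))))"
    by (simp add: sum_distrib_left mult_ac)
  also have "\<dots> = (\<Sum>f\<in>UNIV. (L f)\<^sup>2 / (fact n * fact n) * det (\<chi> i j. G i j))"
  proof (rule sum.cong[OF refl])
    fix f :: "'n \<Rightarrow> 'n"
    \<comment> \<open>Selecting rows is multiplication by a Kronecker matrix from the left, so
      \<open>det_mul\<close> splits off \<open>L f\<close>.\<close>
    have "(\<chi> i j. G (f i) j) = (\<chi> i j. kron (f i) (j::'n)) ** (\<chi> i j. G i j)"
      by (simp add: vec_eq_iff matrix_matrix_mult_def kron_sums)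
    then have "(\<Sum>h\<in>UNIV. L h * (\<Prod>i\<in>UNIV. G (f i) (h i))) = L f * det (\<chi> i j. G i j)"
      unfolding L_def sum_det_kron_prod[of "\<lambda>i j. G (f i) j"] by (simp only: det_mul)
    then show "L f / (fact n * fact n) * (\<Sum>h\<in>UNIV. L h * (\<Prod>i\<in>UNIV. G (f i) (h i)))
      = (L f)\<^sup>2 / (fact n * fact n) * det (\<chi> i j. G i j)" by (simp add: power2_eq_square)
  qed
  also have "\<dots> = (\<Sum>f\<in>UNIV. (L f)\<^sup>2) / (fact n * fact n) * det (\<chi> i j. G i j)"
    by (simp add: sum_distrib_right sum_divide_distrib)
  finally have eq: "gamma_inv r Nf F \<Gamma> x = \<dots>" .
  have "L (\<lambda>i. i) = 1" unfolding L_def using det_I unfolding mat_def .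
  then have "(\<Sum>f\<in>UNIV. (L f)\<^sup>2) > 0"
    by (intro sum_pos2[of UNIV "\<lambda>i. i"]) auto
  then show ?thesis unfolding eq G_def by simp
qed

section \<open>Charts\<close>

lemma overlap_subset: "overlap c c' \<subseteq> cimage c"
  by (auto simp: overlap_def cimage_def)

context
  fixes M :: "'a topology" and A :: "('a, 'n::finite) chart set" and c :: "('a, 'n) chart"
  assumes M: "smooth_manifold M A" and c: "c \<in> A"
begin

lemma open_cimage: "open (cimage c)"
  using M c by (auto simp: smooth_manifold_def is_chart_def)

lemma chart_homeomorphism:
  shows "openin M (fst c)" "topspace (subtopology M (fst c)) = fst c" "inj_on (snd c) (fst c)"
    "homeomorphic_map (subtopology M (fst c)) (top_of_set (cimage c)) (snd c)"
proof -
  show 1: "openin M (fst c)" and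
    2: "homeomorphic_map (subtopology M (fst c)) (top_of_set (cimage c)) (snd c)"
    using M c by (auto simp: smooth_manifold_def is_chart_def)
  show 3: "topspace (subtopology M (fst c)) = fst c"
    using openin_subset[OF 1] by auto
  show "inj_on (snd c) (fst c)"
    using homeomorphic_imp_injective_map[OF 2] 3 by simp
qed

end

context
  fixes M :: "'a topology" and A :: "('a, 'n::finite) chart set" and c c' :: "('a, 'n) chart"
  assumes M: "smooth_manifold M A" and c: "c \<in> A" and c': "c' \<in> A"
begin

lemma smooth_transition: "smooth_fun (overlap c c') (\<lambda>x. transition c c' x $ k)"
  using M c c' by (auto simp: smooth_manifold_def)

lemma open_overlap: "open (overlap c c')"
proof -
  note h = chart_homeomorphism[OF M c] and h' = chart_homeomorphism[OF M c']
  have "openin (subtopology M (fst c)) (fst c \<inter> fst c')"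
    using h'(1) by (auto simp: openin_subtopology intro!: exI[of _ "fst c'"])
  then have "openin (top_of_set (cimage c)) (overlap c c')"
    unfolding overlap_def using homeomorphic_map_openness[OF h(4), of "fst c \<inter> fst c'"] h(2)
    by auto
  then show ?thesis using open_cimage[OF M c] by (meson openin_open_trans)
qed

lemma transition_in: "x \<in> overlap c c' \<Longrightarrow> transition c c' x \<in> overlap c' c"
  and transition_inverse: "x \<in> overlap c c' \<Longrightarrow> transition c' c (transition c c' x) = x"
  using chart_homeomorphism(3)[OF M c] chart_homeomorphism(3)[OF M c']
  by (auto simp: overlap_def transition_def)

end

lemma pd_coordinate: "pd d (\<lambda>y. y $ i) x = kron i d"
proof -
  have "((\<lambda>y. y $ i) has_derivative (\<lambda>y. y $ i)) (at x)"
    by (rule bounded_linear.has_derivative[OF bounded_linear_vec_nth has_derivative_ident])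
  from pd_has_derivative[OF this] show ?thesis by (simp add: axis_def)
qed

text \<open>The chain rule for the round trip between the charts, which is the identity on the whole
  open overlap.\<close>

lemma jac_inverse:
  fixes A :: "('a, 'n::finite) chart set"
  assumes M: "smooth_manifold M A" and c: "c \<in> A" and c': "c' \<in> A" and x: "x \<in> overlap c c'"
  shows "(\<Sum>k\<in>UNIV. jac c' c (transition c c' x) i k * jac c c' x k d) = kron i d"
proof -
  have "pd d (\<lambda>z. transition c' c (transition c c' z) $ i) x =
    (\<Sum>k\<in>UNIV. jac c' c (transition c c' x) i k * jac c c' x k d)"
    unfolding jac_def
    by (rule differentiable_compose_components(2)[where f="\<lambda>z. transition c' c z $ i"];
        rule smooth_fun_differentiable[OF smooth_transition[OF M]]) (use c c' x transition_in[OF M] in auto)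
  moreover have "pd d (\<lambda>z. transition c' c (transition c c' z) $ i) x = pd d (\<lambda>z. z $ i) x"
    by (rule pd_cong[OF open_overlap[OF M c c'] x]) (simp add: transition_inverse[OF M c c'])
  ultimately show ?thesis by (simp add: pd_coordinate)
qed

text \<open>The connections are arbitrary fields on the overlap rather than components of one
  connection on the manifold, so that the pulled-back connection in
  \<open>one_form_\<Upsilon>\<close>, used on an overlap alone, is covered.\<close>

lemma coordinate_change_charts:
  fixes A :: "('a, 'n::finite) chart set"
  assumes M: "smooth_manifold M A" and c: "c \<in> A" and c': "c' \<in> A"
    and "smooth_connection_on (overlap c c') \<Gamma>" "smooth_connection_on (overlap c' c) \<Gamma>'"
    and "\<And>x k a b. x \<in> overlap c c' \<Longrightarrow> (\<Sum>l\<in>UNIV. jac c c' x k l * \<Gamma> x l a b) =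
        pd a (\<lambda>z. jac c c' z k b) x +
        (\<Sum>i\<in>UNIV. \<Sum>j\<in>UNIV. \<Gamma>' (transition c c' x) k i j * jac c c' x i a * jac c c' x j b)"
  shows "coordinate_change (overlap c c') (overlap c' c) (transition c c') (jac c c')
    (\<lambda>x. jac c' c (transition c c' x)) \<Gamma> \<Gamma>'"
proof
  show "(\<Sum>l\<in>UNIV. jac c c' x i l * jac c' c (transition c c' x) l k) = kron i k"
    if x: "x \<in> overlap c c'" for x i k
    using jac_inverse[OF M c' c transition_in[OF M c c' x], of i k] unfolding transition_inverse[OF M c c' x] .
  show "(\<Sum>k\<in>UNIV. jac c' c (transition c c' x) i k * jac c c' x k d) = kron i d"
    if x: "x \<in> overlap c c'" for x i d
    by (rule jac_inverse[OF M c c' x])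
qed (fact assms smooth_transition[OF M c c'] transition_in[OF M c c'] jac_def)+

section \<open>Projective changes on a manifold\<close>

text \<open>The derivatives of \<open>u\<close> on the two sides cancel, and what is left is linear
  in the value of \<open>u\<close> at a point; constant coordinate covectors therefore suffice as
  tests.\<close>

lemma projectively_equivalent_iff:
  fixes A :: "('a, 'n::finite) chart set"
  shows "projectively_equivalent A \<Gamma> \<Gamma>' \<longleftrightarrow> (\<exists>\<Upsilon>. one_form A \<Upsilon> \<and> (\<forall>c\<in>A. \<forall>x\<in>cimage c. \<forall>k a b.
     \<Gamma>' c x k a b = \<Gamma> c x k a b + \<Upsilon> c x a * kron k b + \<Upsilon> c x b * kron k a))"
proof -
  have "(\<forall>u. (\<forall>b. smooth_fun (cimage c) (\<lambda>x. u x b)) \<longrightarrow> (\<forall>x\<in>cimage c. \<forall>a b.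
      nabla1 (\<Gamma>' c) u x a b = nabla1 (\<Gamma> c) u x a b - \<Upsilon> c x a * u x b - \<Upsilon> c x b * u x a)) \<longleftrightarrow>
    (\<forall>x\<in>cimage c. \<forall>k a b. \<Gamma>' c x k a b = \<Gamma> c x k a b + \<Upsilon> c x a * kron k b + \<Upsilon> c x b * kron k a)"
    (is "?l \<longleftrightarrow> ?r") for c :: "('a, 'n) chart" and \<Upsilon>
  proof
    assume l: ?l
    show ?r
    proof (intro ballI allI)
      fix x k a b assume "x \<in> cimage c"
      then have "nabla1 (\<Gamma>' c) (\<lambda>_ l. kron k l) x a b = nabla1 (\<Gamma> c) (\<lambda>_ l. kron k l) x a b
          - \<Upsilon> c x a * kron k b - \<Upsilon> c x b * kron k a"
        using l[rule_format, of "\<lambda>_ l. kron k l"] by simp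
      \<comment> \<open>The zeros are the partial derivatives of the constant test covector, as
        \<open>pd_const\<close> leaves them.\<close>
      moreover have "p = q + s + t" if "0 - p = 0 - q - s - t" for p q s t :: real using that by simp
      ultimately show "\<Gamma>' c x k a b = \<Gamma> c x k a b + \<Upsilon> c x a * kron k b + \<Upsilon> c x b * kron k a"
        unfolding nabla1_def pd_const kron_sums by blast
    qed
  next
    assume r: ?r
    show ?l
    proof (intro allI impI ballI)
      fix u x a b assume x: "x \<in> cimage c"
      have "(\<Sum>l\<in>UNIV. \<Gamma>' c x l a b * u x l) = (\<Sum>l\<in>UNIV. \<Gamma> c x l a b * u x l
          + \<Upsilon> c x a * (kron l b * u x l) + \<Upsilon> c x b * (kron l a * u x l))"
        using r x by (intro sum.cong refl) (simp only: ring_distribs mult_ac)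
      also have "\<dots> = (\<Sum>l\<in>UNIV. \<Gamma> c x l a b * u x l) + \<Upsilon> c x a * u x b + \<Upsilon> c x b * u x a"
        unfolding sum.distrib sum_distrib_left[symmetric] kron_sums ..
      finally show "nabla1 (\<Gamma>' c) u x a b = nabla1 (\<Gamma> c) u x a b - \<Upsilon> c x a * u x b - \<Upsilon> c x b * u x a"
        unfolding nabla1_def by linarith
    qed
  qed
  then show ?thesis unfolding projectively_equivalent_def by simp
qed

text \<open>The added terms are tensorial when \<open>u\<close> transforms as a covector, so the
  inhomogeneous term \<open>d\<close> is the same before and after. The pointwise form serves both a
  global one-form and a covector field on a single overlap.\<close>

lemma transformation_law_change:
  fixes J :: "'n::finite \<Rightarrow> 'n \<Rightarrow> real"
  assumes "(\<Sum>l\<in>UNIV. J k l * \<Gamma> l a b) = d + (\<Sum>i\<in>UNIV. \<Sum>j\<in>UNIV. \<Gamma>' k i j * J i a * J j b)"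
    and u: "\<And>a. u a = (\<Sum>i\<in>UNIV. J i a * u' i)"
  shows "(\<Sum>l\<in>UNIV. J k l * (\<Gamma> l a b + u a * kron l b + u b * kron l a)) =
    d + (\<Sum>i\<in>UNIV. \<Sum>j\<in>UNIV. (\<Gamma>' k i j + u' i * kron k j + u' j * kron k i) * J i a * J j b)"
proof -
  have "(\<Sum>l\<in>UNIV. J k l * (\<Gamma> l a b + u a * kron l b + u b * kron l a)) =
    (\<Sum>l\<in>UNIV. J k l * \<Gamma> l a b + u a * (J k l * kron l b) + u b * (J k l * kron l a))"
    by (intro sum.cong refl) (simp only: ring_distribs mult_ac)
  also have "\<dots> = (\<Sum>l\<in>UNIV. J k l * \<Gamma> l a b) + u a * J k b + u b * J k a"
    unfolding sum.distrib sum_distrib_left[symmetric] kron_sums ..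
  finally have 1: "(\<Sum>l\<in>UNIV. J k l * (\<Gamma> l a b + u a * kron l b + u b * kron l a)) = \<dots>" .
  have "(\<Sum>i\<in>UNIV. \<Sum>j\<in>UNIV. (\<Gamma>' k i j + u' i * kron k j + u' j * kron k i) * J i a * J j b) =
    (\<Sum>i\<in>UNIV. \<Sum>j\<in>UNIV. \<Gamma>' k i j * J i a * J j b + J i a * u' i * (kron k j * J j b)
       + kron k i * (J i a * (J j b * u' j)))"
    by (intro sum.cong refl) (simp only: ring_distribs mult_ac)
  also have "\<dots> = (\<Sum>i\<in>UNIV. \<Sum>j\<in>UNIV. \<Gamma>' k i j * J i a * J j b) + u a * J k b + J k a * u b"
    unfolding sum.distrib sum_distrib_left[symmetric] sum_distrib_right[symmetric] kron_sums u ..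
  finally show ?thesis unfolding 1 assms(1) by (simp add: mult_ac)
qed

lemma torsion_free_smooth_connection_on:
  assumes "smooth_manifold M A" "torsion_free_connection A \<Gamma>" "c \<in> A"
  shows "smooth_connection_on (cimage c) (\<Gamma> c)"
  using assms(2,3) open_cimage[OF assms(1,3)]
  unfolding torsion_free_connection_def smooth_connection_on_def by blast

lemma torsion_free_law:
  assumes "torsion_free_connection A \<Gamma>" "c \<in> A" "c' \<in> A" "x \<in> overlap c c'"
  shows "(\<Sum>l\<in>UNIV. jac c c' x k l * \<Gamma> c x l a b) = pd a (\<lambda>z. jac c c' z k b) x +
     (\<Sum>i\<in>UNIV. \<Sum>j\<in>UNIV. \<Gamma> c' (transition c c' x) k i j * jac c c' x i a * jac c c' x j b)"
  using assms unfolding torsion_free_connection_def by blast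

lemma torsion_free_coordinate_change:
  assumes M: "smooth_manifold M A" and \<Gamma>: "torsion_free_connection A \<Gamma>" and c: "c \<in> A" and c': "c' \<in> A"
  shows "coordinate_change (overlap c c') (overlap c' c) (transition c c') (jac c c')
    (\<lambda>x. jac c' c (transition c c' x)) (\<Gamma> c) (\<Gamma> c')"
  by (intro coordinate_change_charts[OF M c c'] torsion_free_law[OF \<Gamma> c c']
      smooth_connection_on_subset[OF torsion_free_smooth_connection_on[OF M \<Gamma>]] overlap_subset
      open_overlap[OF M] c c')

lemma torsion_free_connection_change:
  assumes M: "smooth_manifold M A" and \<Gamma>: "torsion_free_connection A \<Gamma>" and \<Upsilon>: "one_form A \<Upsilon>"
  shows "torsion_free_connection A (\<lambda>c x k a b. \<Gamma> c x k a b + \<Upsilon> c x a * kron k b + \<Upsilon> c x b * kron k a)"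
  unfolding torsion_free_connection_def
proof (intro conjI ballI allI)
  fix c k a b assume c: "c \<in> A"
  note conn = smooth_connection_onD[OF torsion_free_smooth_connection_on[OF M \<Gamma> c]]
  have "smooth_fun (cimage c) (\<lambda>x. \<Upsilon> c x a)" for a using \<Upsilon> c by (simp add: one_form_def)
  then show "smooth_fun (cimage c) (\<lambda>x. \<Gamma> c x k a b + \<Upsilon> c x a * kron k b + \<Upsilon> c x b * kron k a)"
    by (intro smooth_fun_intros conn)
  fix x assume "x \<in> cimage c"
  then show "\<Gamma> c x k a b + \<Upsilon> c x a * kron k b + \<Upsilon> c x b * kron k a =
     \<Gamma> c x k b a + \<Upsilon> c x b * kron k a + \<Upsilon> c x a * kron k b" by (simp add: conn(3)[of x k a b])
next
  fix c c' x k a b assume c: "c \<in> A" "c' \<in> A" "x \<in> overlap c c'"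
  have u: "\<And>a. \<Upsilon> c x a = (\<Sum>i\<in>UNIV. jac c c' x i a * \<Upsilon> c' (transition c c' x) i)"
    using \<Upsilon> c unfolding one_form_def by blast
  show "(\<Sum>l\<in>UNIV. jac c c' x k l * (\<Gamma> c x l a b + \<Upsilon> c x a * kron l b + \<Upsilon> c x b * kron l a)) =
     pd a (\<lambda>z. jac c c' z k b) x + (\<Sum>i\<in>UNIV. \<Sum>j\<in>UNIV. (\<Gamma> c' (transition c c' x) k i j
       + \<Upsilon> c' (transition c c' x) i * kron k j + \<Upsilon> c' (transition c c' x) j * kron k i)
        * jac c c' x i a * jac c c' x j b)"
    by (rule transformation_law_change[OF torsion_free_law[OF \<Gamma> c] u])
qed

section \<open>The candidate connection on the manifold and the two equivalences\<close>

locale nondegenerate_manifold =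
  fixes M :: "'a topology" and A :: "('a, 'n::{finite,linorder}) chart set"
    and \<Gamma> :: "('a, 'n) chart \<Rightarrow> 'n christoffel"
    and r :: nat and Nf :: "nat \<Rightarrow> nat" and F :: "nat \<times> nat \<Rightarrow> nat"
  assumes dim: "CARD('n) \<ge> 2" and M: "smooth_manifold M A" and Nf0: "Nf 0 \<ge> 1"
    and \<Gamma>: "torsion_free_connection A \<Gamma>"
    and Q: "c \<in> A \<Longrightarrow> x \<in> cimage c \<Longrightarrow> det (Qmat (weyl (\<Gamma> c) x) r Nf F) \<noteq> 0"
begin

lemmas conn = torsion_free_smooth_connection_on[OF M \<Gamma>]

abbreviation (input) "G c \<equiv> Gten r Nf F (\<Gamma> c)"
abbreviation (input) "E c \<equiv> Eten r Nf F (\<Gamma> c)"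

text \<open>A parallel Schouten tensor kills the Cotton tensor of \<open>\<Gamma>'\<close>, which determines \<open>\<Upsilon>\<close>.\<close>
lemma invariants_of_parallel_schouten:
  assumes "projectively_equivalent A \<Gamma> \<Gamma>'"
    and "\<And>i j k x. x \<in> cimage c \<Longrightarrow> nabla2 (\<Gamma>' c) (schouten (\<Gamma>' c)) x i j k = 0"
    and c: "c \<in> A" and x: "x \<in> cimage c"
  shows "G c x i j = schouten (\<Gamma>' c) x i j" and "E c x i j k = 0"
proof -
  obtain \<Upsilon> where \<Upsilon>: "one_form A \<Upsilon>" and eq: "\<And>x k a b. x \<in> cimage c \<Longrightarrow>
      \<Gamma>' c x k a b = \<Gamma> c x k a b + \<Upsilon> c x a * kron k b + \<Upsilon> c x b * kron k a"
    using assms(1) c unfolding projectively_equivalent_iff by blast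
  interpret nondegenerate_projective_change "cimage c" "\<Gamma> c" "\<Gamma>' c" "\<Upsilon> c" r Nf F
    using \<Upsilon> c by unfold_locales (auto simp: conn eq dim Nf0[unfolded One_nat_def] Q one_form_def)
  have "\<Upsilon> c y i = - DC r Nf F (\<Gamma> c) y i" if "y \<in> cimage c" for y i
    by (rule \<Upsilon>_eq_DC[OF that cotton_0_of_schouten_parallel[OF assms(2)[OF that]]])
  note * = Gten_eq_schouten[OF this x] Eten_eq_nabla_schouten[OF this x]
  show "G c x i j = schouten (\<Gamma>' c) x i j" "E c x i j k = 0"
    using * assms(2)[OF x] by simp_all
qed

text \<open>In each chart this is the value forced by \<open>\<Upsilon>_eq_DC\<close>. It is a
  family of coordinate expressions at first; that the charts agree is shown in
  \<open>one_form_\<Upsilon>\<close> under \<open>E = 0\<close>.\<close>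

definition \<Upsilon> :: "('a, 'n) chart \<Rightarrow> real^('n::{finite,linorder}) \<Rightarrow> 'n \<Rightarrow> real" where
  "\<Upsilon> c x i = - DC r Nf F (\<Gamma> c) x i"

definition \<Gamma>' :: "('a, 'n) chart \<Rightarrow> 'n christoffel" where
  "\<Gamma>' c x k a b = \<Gamma> c x k a b + \<Upsilon> c x a * kron k b + \<Upsilon> c x b * kron k a"

lemma smooth_\<Upsilon>: "c \<in> A \<Longrightarrow> smooth_fun (cimage c) (\<lambda>x. \<Upsilon> c x i)"
  unfolding \<Upsilon>_def
  by (intro smooth_fun_uminus smooth_DC open_cimage[OF M] conn Q)

lemma nondegenerate_projective_change:
  "c \<in> A \<Longrightarrow> nondegenerate_projective_change (cimage c) (\<Gamma> c) (\<Gamma>' c) (\<Upsilon> c) r Nf F"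
  by unfold_locales (simp_all add: conn \<Gamma>'_def smooth_\<Upsilon> dim Nf0[unfolded One_nat_def] Q)

lemma
  assumes "c \<in> A" "x \<in> cimage c"
  shows Gten_\<Gamma>': "G c x i j = schouten (\<Gamma>' c) x i j"
    and Eten_\<Gamma>': "E c x i j k = nabla2 (\<Gamma>' c) (schouten (\<Gamma>' c)) x i j k"
  using nondegenerate_projective_change.Gten_eq_schouten[OF nondegenerate_projective_change[OF assms(1)] \<Upsilon>_def assms(2)]
    nondegenerate_projective_change.Eten_eq_nabla_schouten[OF nondegenerate_projective_change[OF assms(1)] \<Upsilon>_def assms(2)]
  by blast+

text \<open>The pullback of \<open>\<Gamma>'\<close> from another chart has vanishing Cotton tensor, too, so
  that \<open>\<Upsilon>\<close> is a one-form because it is determined by the Cotton tensor; the transformation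
  behaviour of \<open>Q\<close> is not needed.\<close>
lemma one_form_\<Upsilon>:
  assumes E: "\<And>c x i j k. c \<in> A \<Longrightarrow> x \<in> cimage c \<Longrightarrow> E c x i j k = 0"
  shows "one_form A \<Upsilon>"
  unfolding one_form_def
proof (intro conjI ballI allI)
  fix c c' x a assume c: "c \<in> A" and c': "c' \<in> A" and x: "x \<in> overlap c c'"
  let ?U = "overlap c c'" and ?V = "overlap c' c" and ?\<tau> = "transition c c'"
  \<comment> \<open>The covector of chart \<open>c'\<close> expressed in chart \<open>c\<close>; the
    aim is to identify it with \<open>\<Upsilon> c\<close> on the overlap.\<close>
  define u where "u x a = (\<Sum>i\<in>UNIV. jac c c' x i a * \<Upsilon> c' (?\<tau> x) i)" for x a
  define \<Gamma>'' where "\<Gamma>'' x k a b = \<Gamma> c x k a b + u x a * kron k b + u x b * kron k a" for x k a b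
  note U = open_overlap[OF M c c'] and V = open_overlap[OF M c' c]
  have sub: "?U \<subseteq> cimage c" "?V \<subseteq> cimage c'" by (rule overlap_subset)+
  have "smooth_fun ?U (\<lambda>x. jac c c' x i a)" for i a
    unfolding jac_def by (intro smooth_fun_pd smooth_transition[OF M c c'])
  moreover have "smooth_fun ?U (\<lambda>x. \<Upsilon> c' (?\<tau> x) i)" for i
    by (rule smooth_fun_compose[OF U transition_in[OF M c c'] smooth_fun_subset[OF smooth_\<Upsilon>[OF c'] sub(2)]
          smooth_transition[OF M c c']])
  ultimately have u: "smooth_fun ?U (\<lambda>x. u x a)" for a
    unfolding u_def by (intro smooth_fun_intros U)
  \<comment> \<open>Here \<open>D\<close> is formed in chart \<open>c\<close>, so uniqueness will
    compare \<open>u\<close> with \<open>DC\<close> of this same chart.\<close>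
  interpret change: nondegenerate_projective_change ?U "\<Gamma> c" \<Gamma>'' u r Nf F
    using smooth_connection_on_subset[OF conn[OF c] U sub(1)] u sub(1)
    by unfold_locales (auto simp: \<Gamma>''_def dim Nf0[unfolded One_nat_def] intro!: Q[OF c])
  \<comment> \<open>\<open>\<Gamma>''\<close> is the pullback of \<open>\<Gamma>' c'\<close>: the
    original connections correspond under the transition, and so do \<open>u\<close> and
    \<open>\<Upsilon> c'\<close>.\<close>
  interpret coordinate_change ?U ?V ?\<tau> "jac c c'" "\<lambda>x. jac c' c (?\<tau> x)" \<Gamma>'' "\<Gamma>' c'"
  proof (rule coordinate_change_charts[OF M c c' change.\<Gamma>'])
    show "smooth_connection_on ?V (\<Gamma>' c')"
      using nondegenerate_projective_change[OF c'] V sub(2)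
      by (intro smooth_connection_on_subset[OF projective_change.\<Gamma>'])
        (auto simp: nondegenerate_projective_change_def)
    show "(\<Sum>l\<in>UNIV. jac c c' x k l * \<Gamma>'' x l a b) = pd a (\<lambda>z. jac c c' z k b) x +
        (\<Sum>i\<in>UNIV. \<Sum>j\<in>UNIV. \<Gamma>' c' (?\<tau> x) k i j * jac c c' x i a * jac c c' x j b)" if "x \<in> ?U" for x k a b
      unfolding \<Gamma>'_def \<Gamma>''_def
      by (rule transformation_law_change[OF torsion_free_law[OF \<Gamma> c c' that] u_def])
  qed
  have "nabla2 (\<Gamma>' c') (schouten (\<Gamma>' c')) y i j k = 0" if "y \<in> ?V" for y i j k
    using E[OF c', of y i j k] Eten_\<Gamma>'[OF c', of y i j k] that sub(2) by auto
  then have "cotton \<Gamma>'' x d a b = 0" for d a b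
    by (intro cotton_0_of_schouten_parallel schouten_parallel_pullback x)
  from change.\<Upsilon>_eq_DC[OF x this]
  show "\<Upsilon> c x a = (\<Sum>i\<in>UNIV. jac c c' x i a * \<Upsilon> c' (transition c c' x) i)"
    unfolding \<Upsilon>_def[of c] u_def by simp
qed (rule smooth_\<Upsilon>)

context
  assumes E: "\<And>c x i j k. c \<in> A \<Longrightarrow> x \<in> cimage c \<Longrightarrow> E c x i j k = 0"
begin

lemma torsion_free_\<Gamma>': "torsion_free_connection A \<Gamma>'"
  using torsion_free_connection_change[OF M \<Gamma> one_form_\<Upsilon>[OF E]] unfolding \<Gamma>'_def[abs_def] .

lemma projectively_equivalent_\<Gamma>': "projectively_equivalent A \<Gamma> \<Gamma>'"
  unfolding projectively_equivalent_iff using one_form_\<Upsilon>[OF E] \<Gamma>'_def by blast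

end

lemma ricci_flat_iff:
  "(\<exists>\<Gamma>'. torsion_free_connection A \<Gamma>' \<and> projectively_equivalent A \<Gamma> \<Gamma>' \<and> ricci_flat A \<Gamma>')
     \<longleftrightarrow> (\<forall>c\<in>A. \<forall>x\<in>cimage c. \<forall>i j. G c x i j = 0)"
proof (intro iffI ballI allI)
  fix c x i j
  assume "\<exists>\<Gamma>'. torsion_free_connection A \<Gamma>' \<and> projectively_equivalent A \<Gamma> \<Gamma>' \<and> ricci_flat A \<Gamma>'"
    and c: "c \<in> A" and x: "x \<in> cimage c"
  then obtain \<Gamma>1 where \<Gamma>1: "projectively_equivalent A \<Gamma> \<Gamma>1" "ricci_flat A \<Gamma>1" by blast
  have P: "schouten (\<Gamma>1 c) y i j = 0" if "y \<in> cimage c" for y i j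
    using \<Gamma>1(2) c that by (simp add: ricci_flat_def schouten_def beta_def)
  have "G c x i j = schouten (\<Gamma>1 c) x i j"
    by (rule invariants_of_parallel_schouten(1)[OF \<Gamma>1(1) schouten_0_parallel[OF open_cimage[OF M c] _ P] c x])
  then show "G c x i j = 0" using P[OF x] by simp
next
  assume G: "\<forall>c\<in>A. \<forall>x\<in>cimage c. \<forall>i j. G c x i j = 0"
  have P: "schouten (\<Gamma>' c) y i j = 0" if "c \<in> A" "y \<in> cimage c" for c y i j
    using G Gten_\<Gamma>'[OF that] that by simp
  \<comment> \<open>\<open>E\<close> is the covariant derivative of a tensor that vanishes on an
    open set. Its vanishing is what lets the chartwise \<open>\<Gamma>'\<close> glue.\<close>
  have E: "E c x i j k = 0" if "c \<in> A" "x \<in> cimage c" for c x i j k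
    unfolding Eten_\<Gamma>'[OF that] by (rule schouten_0_parallel[OF open_cimage[OF M that(1)] that(2) P[OF that(1)]])
  note \<Gamma>' = torsion_free_\<Gamma>'[OF E]
  have "ricci_flat A \<Gamma>'"
    unfolding ricci_flat_def
    using ric_eq_schouten[OF torsion_free_smooth_connection_on[OF M \<Gamma>'] dim] P by simp
  then show "\<exists>\<Gamma>'. torsion_free_connection A \<Gamma>' \<and> projectively_equivalent A \<Gamma> \<Gamma>' \<and> ricci_flat A \<Gamma>'"
    using \<Gamma>' projectively_equivalent_\<Gamma>'[OF E] by blast
qed

lemma einstein_iff:
  "(\<exists>g \<Gamma>' K. pseudo_riemannian_metric A g \<and> levi_civita A g \<Gamma>' \<and>
      einstein A g \<Gamma>' K \<and> K \<noteq> 0 \<and> projectively_equivalent A \<Gamma> \<Gamma>')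
   \<longleftrightarrow> (\<forall>c\<in>A. \<forall>x\<in>cimage c. (\<forall>i j k. E c x i j k = 0) \<and> (\<forall>i j. G c x i j = G c x j i) \<and>
      det (\<chi> i j. G c x i j) \<noteq> 0)"
proof (intro iffI ballI)
  fix c x
  assume "\<exists>g \<Gamma>' K. pseudo_riemannian_metric A g \<and> levi_civita A g \<Gamma>' \<and>
      einstein A g \<Gamma>' K \<and> K \<noteq> 0 \<and> projectively_equivalent A \<Gamma> \<Gamma>'"
    and c: "c \<in> A" and x: "x \<in> cimage c"
  then obtain g \<Gamma>1 K where g: "pseudo_riemannian_metric A g" and lc: "levi_civita A g \<Gamma>1"
    and e: "einstein A g \<Gamma>1 K" and K: "K \<noteq> 0" and pe: "projectively_equivalent A \<Gamma> \<Gamma>1" by blast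
  \<comment> \<open>The factor between the metric and its Schouten tensor, by
    \<open>schouten_einstein\<close>. It is nonzero because \<open>K\<close> is, and so carries
    nondegeneracy from \<open>g\<close> over to \<open>G\<close>.\<close>
  define q where "q = K / (real CARD('n) - 1)"
  have q: "q \<noteq> 0" using K dim by (simp add: q_def)
  have sg: "smooth_fun (cimage c) (\<lambda>x. g c x i j)" for i j
    using g c by (simp add: pseudo_riemannian_metric_def)
  have sym: "g c y i j = g c y j i" "det (\<chi> i j. g c y i j) \<noteq> 0" if "y \<in> cimage c" for y i j
    using g c that unfolding pseudo_riemannian_metric_def by blast+
  have P: "schouten (\<Gamma>1 c) y i j = q * g c y i j" if "y \<in> cimage c" for y i j
    unfolding q_def using e c that by (intro schouten_einstein sym) (auto simp: einstein_def)
  have par: "nabla2 (\<Gamma>1 c) (schouten (\<Gamma>1 c)) y i j k = 0" if y: "y \<in> cimage c" for y i j k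
  proof -
    have "nabla2 (\<Gamma>1 c) (schouten (\<Gamma>1 c)) y i j k = nabla2 (\<Gamma>1 c) (\<lambda>y i j. q * g c y i j) y i j k"
      by (rule nabla2_cong[OF open_cimage[OF M c] y P])
    also have "\<dots> = q * nabla2 (\<Gamma>1 c) (g c) y i j k"
      by (rule nabla2_cmult[OF smooth_fun_differentiable[OF sg y]])
    also have "\<dots> = 0" using lc c y by (simp add: levi_civita_def)
    finally show ?thesis .
  qed
  have G: "G c x i j = q * g c x i j" for i j
    using invariants_of_parallel_schouten(1)[OF pe par c x] P[OF x] by simp
  have "det (\<chi> i j. G c x i j) = det (\<chi> i. q *s (\<chi> j. g c x i j))"
    by (rule arg_cong[of _ _ det]) (simp add: vec_eq_iff G)
  also have "\<dots> \<noteq> 0" using q sym(2)[OF x] by (simp add: det_rows_mul)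
  finally show "(\<forall>i j k. E c x i j k = 0) \<and> (\<forall>i j. G c x i j = G c x j i) \<and> det (\<chi> i j. G c x i j) \<noteq> 0"
    using invariants_of_parallel_schouten(2)[OF pe par c x] G sym(1)[OF x] by simp
next
  assume r: "\<forall>c\<in>A. \<forall>x\<in>cimage c. (\<forall>i j k. E c x i j k = 0) \<and> (\<forall>i j. G c x i j = G c x j i) \<and>
      det (\<chi> i j. G c x i j) \<noteq> 0"
  then have E: "E c x i j k = 0" if "c \<in> A" "x \<in> cimage c" for c x i j k using that by blast
  note \<Gamma>' = torsion_free_\<Gamma>'[OF E]
  \<comment> \<open>The metric is the Schouten tensor of \<open>\<Gamma>'\<close>, which in each
    chart equals \<open>G\<close>. Coming from a global connection, it transforms as a tensor by
    \<open>schouten_pullback\<close>, and \<open>E = 0\<close> says that it is parallel.\<close>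
  define g where "g c = schouten (\<Gamma>' c)" for c
  note Gg = Gten_\<Gamma>'[folded g_def]
  have sym: "g c x i j = g c x j i" and det: "det (\<chi> i j. g c x i j) \<noteq> 0" if "c \<in> A" "x \<in> cimage c" for c x i j
    unfolding Gg[OF that, symmetric] using r that by blast+
  have "pseudo_riemannian_metric A g"
    unfolding pseudo_riemannian_metric_def
  proof (intro conjI ballI allI)
    show "smooth_fun (cimage c) (\<lambda>x. g c x a b)" if "c \<in> A" for c a b
      unfolding g_def by (rule smooth_schouten[OF torsion_free_smooth_connection_on[OF M \<Gamma>' that]])
    show "g c x a b = (\<Sum>i\<in>UNIV. \<Sum>j\<in>UNIV. jac c c' x i a * jac c c' x j b * g c' (transition c c' x) i j)"
      if "c \<in> A" "c' \<in> A" "x \<in> overlap c c'" for c c' x a b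
      unfolding g_def
      by (rule coordinate_change.schouten_pullback[OF torsion_free_coordinate_change[OF M \<Gamma>' that(1,2)] that(3)])
  qed (fact sym det)+
  moreover have "levi_civita A g \<Gamma>'"
    unfolding levi_civita_def g_def using \<Gamma>' Eten_\<Gamma>' E by simp
  \<comment> \<open>The constant is the factor between a symmetric Schouten tensor and the Ricci
    tensor in \<open>ric_eq_schouten\<close>.\<close>
  moreover have "einstein A g \<Gamma>' (real CARD('n) - 1)"
    unfolding einstein_def
    using ric_eq_schouten[OF torsion_free_smooth_connection_on[OF M \<Gamma>'] dim] sym by (simp add: g_def)
  moreover have "real CARD('n) - 1 \<noteq> 0" using dim by simp
  ultimately show "\<exists>g \<Gamma>' K. pseudo_riemannian_metric A g \<and> levi_civita A g \<Gamma>' \<and>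
      einstein A g \<Gamma>' K \<and> K \<noteq> 0 \<and> projectively_equivalent A \<Gamma> \<Gamma>'"
    using projectively_equivalent_\<Gamma>'[OF E] by blast
qed

end

theorem theorem5p8:
  fixes M :: "'a topology"
    and A :: "('a, 'n::{finite,linorder}) chart set"
    and \<Gamma> :: "('a, 'n) chart \<Rightarrow> 'n christoffel"
    and N r :: nat and Nf :: "nat \<Rightarrow> nat" and F :: "nat \<times> nat \<Rightarrow> nat"
  assumes "CARD('n) \<ge> 2"
    and "smooth_manifold M A"
    and "valid_inputs CARD('n) N 0 r Nf F"
    and "Nf 0 \<ge> 1"
    and "torsion_free_connection A \<Gamma>"
    and "\<forall>c\<in>A. \<forall>x\<in>cimage c. det (Qmat (weyl (\<Gamma> c) x) r Nf F) \<noteq> 0"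
  shows "((\<exists>\<Gamma>'. torsion_free_connection A \<Gamma>' \<and> projectively_equivalent A \<Gamma> \<Gamma>' \<and> ricci_flat A \<Gamma>')
           \<longleftrightarrow> (\<forall>c\<in>A. \<forall>x\<in>cimage c. \<forall>i j. Gten r Nf F (\<Gamma> c) x i j = 0))
       \<and> ((\<exists>g \<Gamma>' K. pseudo_riemannian_metric A g \<and> levi_civita A g \<Gamma>' \<and>
              einstein A g \<Gamma>' K \<and> K \<noteq> 0 \<and> projectively_equivalent A \<Gamma> \<Gamma>')
           \<longleftrightarrow> (\<forall>c\<in>A. \<forall>x\<in>cimage c.
                  (\<forall>i j k. Eten r Nf F (\<Gamma> c) x i j k = 0) \<and>
                  (\<forall>i j. (Gten r Nf F (\<Gamma> c) x i j - Gten r Nf F (\<Gamma> c) x j i) / 2 = 0) \<and>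
                  gamma_inv r Nf F (\<Gamma> c) x \<noteq> 0))"
proof -
  interpret nondegenerate_manifold M A \<Gamma> r Nf F
    by unfold_locales (use assms in auto)
  show ?thesis using ricci_flat_iff einstein_iff by (simp add: gamma_inv_nonzero_iff)
qed

end
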